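(* Let $s=\sigma+i\tau$ with $\sigma,\tau\in\mathbb R$ and $\sigma>1$. Then for every $B\geq\zeta(\sigma)^2$ the set $S_{B,s}$ is infinite (the Northcott property does not hold at $s$ for $B$).
   Context: For a number field $K$ let $\zeta_K$ be its Dedekind zeta function and $\zeta_K^*(s)$ the first nonzero coefficient of its expansion at $s$ (for $\sigma>1$ this is $\zeta_K(s)$). For $B>0$, $S_{B,s}$ is the set of isomorphism classes $[K]$ of number fields with $|\zeta_K^*(s)|\le B$. $\zeta$ is the Riemann zeta function. *)

theory Defs
  imports
    "HOL-Complex_Analysis.Complex_Analysis"
    "HOL-Algebra.Algebraic_Closure_Type"
    "HOL-Algebra.QuotRing"
    "HOL-Algebra.Embedded_Algebras"
begin

text \<open>
  Number fields are realised as subfields of the complex numbers; every number field is isomorphic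
  to one of these, so they represent all isomorphism classes.
\<close>

abbreviation complex_ring :: "complex ring" where
  "complex_ring \<equiv> ring_of_type_algebra"

definition number_field :: "complex set \<Rightarrow> bool" where
  "number_field K \<longleftrightarrow> subfield K complex_ring \<and> ring.finite_dimension complex_ring \<rat> K"

definition field_iso :: "complex set \<Rightarrow> complex set \<Rightarrow> bool" where
  "field_iso K L \<longleftrightarrow> complex_ring\<lparr>carrier := K\<rparr> \<simeq> complex_ring\<lparr>carrier := L\<rparr>"

definition iso_class :: "complex set \<Rightarrow> complex set set" where
  "iso_class K = {L. number_field L \<and> field_iso K L}"

definition ring_of_integers :: "complex set \<Rightarrow> complex ring" where
  "ring_of_integers K = complex_ring\<lparr>carrier := {x \<in> K. algebraic_int x}\<rparr>"

definition nonzero_ideals :: "complex set \<Rightarrow> complex set set" where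
  "nonzero_ideals K = {I. ideal I (ring_of_integers K) \<and> I \<noteq> {0}}"

definition ideal_norm :: "complex set \<Rightarrow> complex set \<Rightarrow> nat" where
  "ideal_norm K I = card (carrier (ring_of_integers K Quot I))"

text \<open>The Dirichlet series of the Dedekind zeta function, meaningful for \<open>Re s > 1\<close>.\<close>

definition dedekind_series :: "complex set \<Rightarrow> complex \<Rightarrow> complex" where
  "dedekind_series K s = (\<Sum>\<^sub>\<infinity>I\<in>nonzero_ideals K. of_nat (ideal_norm K I) powr (- s))"

text \<open>
  A meromorphic continuation of the Dedekind zeta function to the half-plane \<open>Re z > c\<close>, where
  \<open>c \<le> 1\<close>. By the identity theorem it is unique up to its values on a discrete set,
  so its Laurent expansions are unique.
\<close>

definition is_dedekind_zeta_on :: "complex set \<Rightarrow> real \<Rightarrow> (complex \<Rightarrow> complex) \<Rightarrow> bool" where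
  "is_dedekind_zeta_on K c f \<longleftrightarrow> c \<le> 1 \<and> f meromorphic_on {z. Re z > c} \<and>
     (\<forall>z. Re z > 1 \<longrightarrow> f z = dedekind_series K z)"

text \<open>
  The first nonzero Laurent coefficient at \<open>s\<close>. Quantifying over the half-plane makes the
  definition meaningful at every complex \<open>s\<close> without presupposing the continuation theorem.
\<close>

definition dedekind_zeta_star :: "complex set \<Rightarrow> complex \<Rightarrow> complex" where
  "dedekind_zeta_star K s = (THE a. \<exists>c f F. c < Re s \<and> is_dedekind_zeta_on K c f \<and>
     (\<lambda>w. f (s + w)) has_laurent_expansion F \<and> a = fls_nth F (fls_subdegree F))"

definition northcott_set :: "real \<Rightarrow> complex \<Rightarrow> complex set set set" where
  "northcott_set B s = {iso_class K | K. number_field K \<and> norm (dedekind_zeta_star K s) \<le> B}"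

text \<open>The Riemann zeta function at real arguments \<open>\<sigma> > 1\<close>.\<close>

definition riemann_zeta :: "real \<Rightarrow> real" where
  "riemann_zeta \<sigma> = (\<Sum>n. 1 / real (Suc n) powr \<sigma>)"

end

theory Submission
  imports Defs "HOL-Number_Theory.Cong"
begin

text \<open>
  We use real quadratic fields \<open>K = \<rat>(\<omega>)\<close>, \<open>\<omega>\<^sup>2 = \<omega> + k\<close>, with \<open>4k + 1\<close> squarefree, in which all
  primes up to a bound \<open>N\<close> are inert, i.e. \<open>x\<^sup>2 + x - k\<close> has no root modulo them; such \<open>k\<close> come from
  the Chinese remainder theorem and passing to the squarefree part of the discriminant. The nonzero
  ideals of \<open>\<int>[\<omega>]\<close> are the lattices \<open>m (a \<int> + (b + \<omega>) \<int>)\<close> with \<open>a | b\<^sup>2 + b - k\<close>, of norm \<open>m\<^sup>2 a\<close>.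
  If \<open>b\<^sub>0\<close> is a fixed root modulo \<open>a\<close>, every root \<open>b\<close> is determined by the divisor \<open>gcd a (b - b\<^sub>0)\<close>
  of \<open>a\<close>; hence ideals inject into triples \<open>(m, u, v)\<close> with norm \<open>m\<^sup>2 u v\<close>, where \<open>u v = 1\<close> or \<open>u v > N\<close>.
  So the terms of the Dedekind series other than that of the unit ideal have absolute sum at most
  \<open>\<zeta>(2\<sigma>) - 1\<close> plus the tail of a convergent series that does not depend on \<open>K\<close>. For large \<open>N\<close> this
  is less than 1, which gives \<open>\<zeta>\<^sub>K(s) \<noteq> 0\<close> without an Euler product, and less than \<open>\<zeta>(\<sigma>)\<^sup>2 - 1\<close>.
\<close>

subsection \<open>Roots of the quadratic polynomial modulo integers\<close>

text \<open>The map x -> x^2 + x takes the value 0 at the distinct residues 0 and -1, so it is not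
  injective modulo \<open>p\<close>; on a finite set it is then not surjective, and a missed value
  is the required \<open>c\<close>.\<close>

lemma exists_no_root_mod:
  fixes p :: nat
  assumes "p \<ge> 2"
  shows "\<exists>c<p. \<forall>x::int. \<not> int p dvd x ^ 2 + x - int c"
proof (rule ccontr)
  assume "\<not> ?thesis"
  then obtain r where r: "\<And>c. c < p \<Longrightarrow> int p dvd (r c) ^ 2 + r c - int c"
    by metis
  \<comment> \<open>If every value were attained, the chosen roots reduced to residues would give a
    self-map of \<open>{..<p}\<close>. It is injective because a root determines the value, hence it
    is surjective and hits both 0 and \<open>p - 1\<close>.\<close>
  define s where "s c = nat (r c mod int p)" for c
  have s: "int p dvd int (s c) ^ 2 + int (s c) - int c" "s c < p" if "c < p" for c
  proof -
    have "[int (s c) = r c] (mod int p)"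
      using assms by (simp add: s_def cong_def)
    then have "[int (s c) ^ 2 + int (s c) - int c = (r c) ^ 2 + r c - int c] (mod int p)"
      by (intro cong_add cong_diff cong_pow cong_refl)
    then show "int p dvd int (s c) ^ 2 + int (s c) - int c"
      using r[OF that] cong_dvd_iff by blast
    show "s c < p"
      using assms by (simp add: s_def nat_less_iff)
  qed
  have "inj_on s {..<p}"
  proof (rule inj_onI)
    fix c d assume cd: "c \<in> {..<p}" "d \<in> {..<p}" "s c = s d"
    then have "int p dvd (int (s c) ^ 2 + int (s c) - int c) - (int (s d) ^ 2 + int (s d) - int d)"
      using s(1)[of c] s(1)[of d] by (meson dvd_diff lessThan_iff)
    then have "int p dvd int d - int c"
      using cd by simp
    then show "c = d"
      using cd by (metis cong_iff_dvd_diff cong_int_iff cong_less_modulus_unique_nat lessThan_iff)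
  qed
  then have "s ` {..<p} = {..<p}"
    using s by (intro card_subset_eq) (auto simp: card_image)
  then obtain c d where cd: "c < p" "d < p" "s c = 0" "s d = p - 1"
  proof -
    have "0 \<in> s ` {..<p}" "p - 1 \<in> s ` {..<p}"
      using assms \<open>s ` {..<p} = {..<p}\<close> by auto
    then show ?thesis
      using that by (metis imageE lessThan_iff)
  qed
  \<comment> \<open>Both residues 0 and -1 are roots for the value 0 only, so \<open>c\<close> and
    \<open>d\<close> coincide although \<open>s\<close> separates them.\<close>
  have "c = 0"
    using s(1)[OF cd(1)] cd by (auto dest: dvd_imp_le)
  moreover have "int p dvd int p * (int p - 1) - int d"
    using s(1)[OF cd(2)] cd(4) assms by (simp add: of_nat_diff power2_eq_square algebra_simps)
  then have "int p dvd int d"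
    by (simp add: dvd_diff_right_iff)
  then have "d = 0"
    using cd(2) by (auto dest: dvd_imp_le)
  ultimately show False
    using cd assms by simp
qed

text \<open>The Chinese remainder theorem yields some \<open>k0\<close> without roots modulo the
  small primes. Writing 4 \<open>k0\<close> + 1 = \<open>e\<close> \<open>f\<close>^2 with
  \<open>e\<close> squarefree, the \<open>k\<close> with 4 \<open>k\<close> + 1 = \<open>e\<close>
  inherits the absence of roots. A prime divisor of the discriminant always admits a root, so all
  prime divisors of \<open>e\<close> are large, and this makes \<open>k\<close> large.\<close>

lemma exists_squarefree_no_small_roots:
  "\<exists>k::int. k > int N \<and> squarefree (4 * k + 1) \<and>
     (\<forall>p::nat. Factorial_Ring.prime p \<and> p \<le> N \<longrightarrow> (\<forall>x. \<not> int p dvd x ^ 2 + x - k))"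
proof -
  \<comment> \<open>With this bound a prime divisor \<open>p > M\<close> of \<open>e\<close> = 4
    \<open>k\<close> + 1 forces \<open>k > N\<close>; also 2 is among the primes treated.\<close>
  define M where "M = 4 * N + 4"
  define P where "P = {p::nat. Factorial_Ring.prime p \<and> p \<le> M}"
  have fin: "finite P"
    by (rule finite_subset[of _ "{..M}"]) (auto simp: P_def)
  have two: "2 \<in> P"
    by (simp add: P_def M_def)
  obtain c where c: "\<And>p x. p \<in> P \<Longrightarrow> \<not> int p dvd (x::int) ^ 2 + x - int (c p)"
  proof -
    have "\<exists>c. \<forall>x::int. \<not> int p dvd x ^ 2 + x - int c" if "p \<in> P" for p
      using exists_no_root_mod[of p] that by (auto simp: P_def prime_ge_2_nat)
    then show ?thesis
      using that by metis
  qed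
  obtain k0 :: nat where k0: "\<And>p. p \<in> P \<Longrightarrow> [k0 = c p] (mod p)"
    using chinese_remainder_nat[OF fin, of "\<lambda>p. p" c] by (auto simp: P_def primes_coprime)
  have nr0: "\<not> int p dvd x ^ 2 + x - int k0" if "p \<in> P" for p x
  proof -
    have "[x ^ 2 + x - int k0 = x ^ 2 + x - int (c p)] (mod int p)"
      using k0[OF that] by (intro cong_diff cong_refl) (simp add: cong_int_iff)
    then show ?thesis
      using c[OF that] cong_dvd_iff by blast
  qed
  define d where "d = 4 * int k0 + 1"
  define e where "e = squarefree_part d"
  define f where "f = square_part d"
  have d: "d = e * f ^ 2"
    unfolding e_def f_def by (rule squarefree_decompose)
  have "d > 0"
    by (simp add: d_def)
  then have "e > 0"
    using d by (simp add: zero_less_mult_iff)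
  have "odd d"
    by (simp add: d_def)
  then have "odd f"
    using d by auto
  then obtain j where j: "f = 2 * j + 1"
    by (elim oddE)
  \<comment> \<open>Solves \<open>e\<close> = 4 \<open>k\<close> + 1: from \<open>f\<close> = 2
    \<open>j\<close> + 1 follows 4 \<open>k0\<close> + 1 = \<open>e\<close> (4 (\<open>j\<close>^2 +
    \<open>j\<close>) + 1).\<close>
  define k where "k = int k0 - e * (j ^ 2 + j)"
  have e: "e = 4 * k + 1"
    using d by (simp add: d_def k_def j power2_eq_square algebra_simps)
  have nr: "\<not> int p dvd x ^ 2 + x - k" if "p \<in> P" for p x
  proof
    assume "int p dvd x ^ 2 + x - k"
    \<comment> \<open>Chosen so that 2 \<open>y\<close> + 1 = \<open>f\<close> (2 \<open>x\<close> +
      1): after completing the square, a root for \<open>k\<close> is carried to a root for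
      \<open>k0\<close>.\<close>
    define y where "y = f * x + j"
    have "4 * (y ^ 2 + y - int k0) = (2 * y + 1) ^ 2 - d"
      by (simp add: d_def power2_eq_square algebra_simps)
    also have "\<dots> = 4 * (f ^ 2 * (x ^ 2 + x - k))"
      by (simp add: y_def d e) (simp add: j power2_eq_square algebra_simps)
    finally have "y ^ 2 + y - int k0 = f ^ 2 * (x ^ 2 + x - k)"
      by simp
    then have "int p dvd y ^ 2 + y - int k0"
      using \<open>int p dvd x ^ 2 + x - k\<close> by simp
    then show False
      using nr0 that by blast
  qed
  have "k \<noteq> 0"
    using nr[OF two, of 0] by auto
  then have "e > 1"
    using e \<open>e > 0\<close> by linarith
  then have "nat \<bar>e\<bar> \<noteq> 1"
    by linarith
  then obtain p :: nat where p: "Factorial_Ring.prime p" "int p dvd e"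
    unfolding dvd_nat_abs_iff[symmetric] using prime_factor_nat by blast
  have "odd p"
  proof
    assume "even p"
    then have "2 dvd e"
      using p(2) by (meson dvd_trans even_of_nat)
    then show False
      by (simp add: e)
  qed
  \<comment> \<open>Since 2 \<open>h\<close> + 1 vanishes modulo \<open>p\<close> and
    \<open>p\<close> divides the discriminant \<open>e\<close>, this \<open>h\<close> is the double
    root modulo \<open>p\<close>.\<close>
  then obtain h where h: "p = 2 * h + 1"
    by (elim oddE)
  have "4 * ((int h) ^ 2 + int h - k) = (int p) ^ 2 - e"
    by (simp add: h e power2_eq_square algebra_simps)
  then have "int p dvd 4 * ((int h) ^ 2 + int h - k)"
    using p by simp
  moreover have "Rings.coprime (int p) 4"
    using \<open>odd p\<close> coprime_power_right_iff[of "int p" 2 2] by simp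
  ultimately have "int p dvd (int h) ^ 2 + int h - k"
    by (metis coprime_dvd_mult_right_iff)
  then have "p \<notin> P"
    using nr by blast
  then have "int p > 4 * int N + 4"
    using p by (simp add: P_def M_def)
  moreover have "int p \<le> e"
    using p \<open>e > 0\<close> by (simp add: zdvd_imp_le)
  ultimately have "k > int N"
    using e by linarith
  moreover have "squarefree (4 * k + 1)"
    unfolding e[symmetric] e_def by simp
  ultimately show ?thesis
    using nr by (intro exI[of _ k]) (auto simp: P_def M_def)
qed

text \<open>For a root b, \<open>a\<close> divides (b - \<open>b0\<close>) (b + \<open>b0\<close> +
  1). With g the common gcd, b is congruent to \<open>b0\<close> modulo g and to -\<open>b0\<close>
  - 1 modulo \<open>a\<close>/g. These moduli are coprime because the discriminant is squarefree, so
  b is determined modulo \<open>a\<close>.\<close>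

lemma root_eq_of_gcd_eq:
  fixes k a b0 b1 b2 :: int
  assumes "a > 0" and sf: "squarefree (4 * k + 1)"
    and b0: "a dvd b0 ^ 2 + b0 - k" and b1: "a dvd b1 ^ 2 + b1 - k" and b2: "a dvd b2 ^ 2 + b2 - k"
    and eq: "gcd a (b1 - b0) = gcd a (b2 - b0)"
  shows "a dvd b1 - b2"
proof -
  define g where "g = gcd a (b1 - b0)"
  have g: "g > 0" "g dvd a" "g dvd b1 - b0" "g dvd b2 - b0"
    using assms(1) by (simp_all add: g_def) (simp add: eq)
  have cofactor: "a div g dvd b + b0 + 1" if "a dvd b ^ 2 + b - k" "gcd a (b - b0) = g" for b
  proof -
    have "(b ^ 2 + b - k) - (b0 ^ 2 + b0 - k) = (b - b0) * (b + b0 + 1)"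
      by (simp add: power2_eq_square algebra_simps)
    then have "a dvd (b - b0) * (b + b0 + 1)"
      using that(1) b0 by (metis dvd_diff)
    moreover have "a = g * (a div g)" "b - b0 = g * ((b - b0) div g)"
      using g that(2) by auto
    ultimately have "g * (a div g) dvd g * (((b - b0) div g) * (b + b0 + 1))"
      by (metis mult.assoc)
    then have "a div g dvd ((b - b0) div g) * (b + b0 + 1)"
      using g by (subst (asm) dvd_mult_cancel_left) auto
    moreover have "Rings.coprime (a div g) ((b - b0) div g)"
      using assms(1) unfolding that(2)[symmetric] by (intro div_gcd_coprime) simp
    ultimately show ?thesis
      by (simp add: coprime_dvd_mult_right_iff)
  qed
  have c1: "a div g dvd b1 + b0 + 1" and c2: "a div g dvd b2 + b0 + 1"
    using cofactor b1 b2 eq by (auto simp: g_def)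
  \<comment> \<open>A common divisor p divides the sum 2 \<open>b1\<close> + 1 of
    \<open>b1 - b0\<close> and \<open>b1 + b0 + 1\<close>, while p^2 divides \<open>a\<close>. Hence
    p^2 divides (2 \<open>b1\<close> + 1)^2 - 4 (\<open>b1\<close>^2 + \<open>b1\<close> -
    \<open>k\<close>) = 4 \<open>k\<close> + 1.\<close>
  have "Rings.coprime g (a div g)"
  proof (rule coprimeI)
    fix p assume p: "p dvd g" "p dvd a div g"
    have "p dvd b1 - b0" "p dvd b1 + b0 + 1"
      using p g c1 by (meson dvd_trans)+
    then have "p dvd (b1 - b0) + (b1 + b0 + 1)"
      by (rule dvd_add)
    then have "p dvd 2 * b1 + 1"
      by (simp add: algebra_simps)
    then have "p ^ 2 dvd (2 * b1 + 1) ^ 2"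
      by (rule dvd_power_same)
    moreover have "p ^ 2 dvd a"
      using mult_dvd_mono[OF p] g by (simp add: power2_eq_square)
    then have "p ^ 2 dvd 4 * (b1 ^ 2 + b1 - k)"
      using b1 by (meson dvd_mult dvd_trans)
    moreover have "4 * k + 1 = (2 * b1 + 1) ^ 2 - 4 * (b1 ^ 2 + b1 - k)"
      by (simp add: power2_eq_square algebra_simps)
    ultimately have "p ^ 2 dvd 4 * k + 1"
      by (metis dvd_diff)
    then show "is_unit p"
      using sf squarefreeD by blast
  qed
  moreover have "g dvd b1 - b2"
    using dvd_diff[OF g(3,4)] by simp
  moreover have "a div g dvd b1 - b2"
    using dvd_diff[OF c1 c2] by simp
  ultimately have "g * (a div g) dvd b1 - b2"
    by (simp add: divides_mult)
  then show ?thesis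
    using g by simp
qed

subsection \<open>Quadratic fields and their integers\<close>

text \<open>If q is the reduced denominator of \<open>r\<close>, then q^j divides \<open>D\<close>
  for every j. Taking j = \<open>D\<close> gives q^\<open>D\<close> \<le> \<open>D\<close> <
  2^\<open>D\<close>, so q = 1.\<close>

lemma rat_int_if_powers_bounded_denom:
  fixes r :: rat and D :: int
  assumes "D > 0" and int: "\<And>j. of_int D * r ^ j \<in> \<int>"
  shows "r \<in> \<int>"
proof -
  obtain p q where pq: "quotient_of r = (p, q)"
    by (cases "quotient_of r")
  have r: "r = of_int p / of_int q" and q: "q > 0" and cop: "Rings.coprime p q"
    using pq quotient_of_div quotient_of_denom_pos quotient_of_coprime by blast+
  have "q ^ nat D dvd D"
  proof -
    obtain z where z: "of_int D * r ^ nat D = of_int z"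
      using int by (auto elim!: Ints_cases)
    then have "of_int (D * p ^ nat D) = (of_int (z * q ^ nat D) :: rat)"
      using q by (simp add: r power_divide field_simps)
    then have "D * p ^ nat D = z * q ^ nat D"
      by (simp only: of_int_eq_iff)
    then have "q ^ nat D dvd D * p ^ nat D"
      by simp
    then show ?thesis
      using cop by (simp add: coprime_dvd_mult_left_iff coprime_commute)
  qed
  then have "q ^ nat D \<le> D"
    using assms(1) by (rule zdvd_imp_le)
  moreover have "D < 2 ^ nat D"
    using assms(1) of_nat_less_two_power[of "nat D", where ?'a = int] by simp
  ultimately have "q ^ nat D < 2 ^ nat D"
    by linarith
  then have "q < 2"
    by (rule power_less_imp_less_base) simp
  then have "q = 1"
    using q by simp
  then show ?thesis
    by (simp add: r)
qed

text \<open>The square of the reduced denominator of \<open>r\<close> must divide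
  \<open>d\<close>.\<close>

lemma rat_int_if_square_times_squarefree:
  fixes r :: rat and d :: int
  assumes "squarefree d" and "r ^ 2 * of_int d \<in> \<int>"
  shows "r \<in> \<int>"
proof -
  obtain p q where pq: "quotient_of r = (p, q)"
    by (cases "quotient_of r")
  have r: "r = of_int p / of_int q" and q: "q > 0" and cop: "Rings.coprime p q"
    using pq quotient_of_div quotient_of_denom_pos quotient_of_coprime by blast+
  obtain z where z: "r ^ 2 * of_int d = of_int z"
    using assms(2) by (auto elim!: Ints_cases)
  then have "of_int (p ^ 2 * d) = (of_int (z * q ^ 2) :: rat)"
    using q by (simp add: r power_divide field_simps)
  then have "p ^ 2 * d = z * q ^ 2"
    by (simp only: of_int_eq_iff)
  then have "q ^ 2 dvd p ^ 2 * d"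
    by simp
  then have "q ^ 2 dvd d"
    using cop by (simp add: coprime_dvd_mult_right_iff coprime_commute)
  then have "q dvd 1"
    using assms(1) by (rule squarefreeD[rotated])
  then have "q = 1"
    using q by simp
  then show ?thesis
    by (simp add: r)
qed

text \<open>Here \<open>r\<close> is an integer whose square divides the squarefree
  \<open>e\<close>, hence a unit. This shows both that discriminants are not rational squares and
  that different discriminants give different fields.\<close>

lemma squarefree_eq_if_square_multiple:
  fixes r :: rat and d e :: int
  assumes "squarefree d" "squarefree e" "r ^ 2 * of_int d = of_int e"
  shows "d = e"
proof -
  have "r \<in> \<int>"
    by (rule rat_int_if_square_times_squarefree[OF assms(1)]) (simp add: assms(3))
  then obtain p where "r = of_int p"
    by (auto elim!: Ints_cases)
  then have "of_int (p ^ 2 * d) = (of_int e :: rat)"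
    using assms(3) by simp
  then have e: "p ^ 2 * d = e"
    by (simp only: of_int_eq_iff)
  then have "p dvd 1"
    using assms(2) by (metis dvd_triv_left squarefreeD)
  then have "p ^ 2 = 1"
    by (auto simp: zdvd1_eq abs_square_eq_1)
  then show ?thesis
    using e by simp
qed

section \<open>Operations of the complex field\<close>

lemma complex_ring_simps [simp]:
  "carrier complex_ring = UNIV" "monoid.mult complex_ring = (*)" "one complex_ring = 1"
  "ring.zero complex_ring = 0" "add complex_ring = (+)"
  by (simp_all add: ring_of_type_algebra_def fun_eq_iff)

lemma complex_ring_field: "field complex_ring"
  by (rule field_from_type_algebra)

lemma complex_ring_a_inv [simp]: "a_inv complex_ring x = - x"
proof -
  interpret field complex_ring by (rule complex_ring_field)
  show ?thesis
    using minus_equality[of "-x" x] by simp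
qed

lemma complex_ring_m_inv: "x \<noteq> 0 \<Longrightarrow> m_inv complex_ring x = inverse x"
proof -
  assume "x \<noteq> 0"
  interpret field complex_ring by (rule complex_ring_field)
  show ?thesis
    using comm_inv_char[of x "inverse x"] \<open>x \<noteq> 0\<close> by simp
qed

section \<open>Real quadratic fields and the order generated by \<omega>\<close>

locale real_quadratic =
  fixes k :: int
  assumes k_pos: "k > 0" and squarefree_disc: "squarefree (4 * k + 1)"
begin

text \<open>The positive root of x^2 - x - \<open>k\<close>. Its discriminant 4 \<open>k\<close> + 1
  is squarefree and 1 modulo 4, the case in which 1 and \<omega> form an integral basis.\<close>

definition \<omega> :: complex where
  "\<omega> = of_real ((1 + sqrt (4 * of_int k + 1)) / 2)"

definition qfield :: "complex set" where
  "qfield = {of_rat a + of_rat b * \<omega> | a b. True}"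

definition qint :: "complex set" where
  "qint = {of_int u + of_int v * \<omega> | u v. True}"

lemma omega_square: "\<omega> * \<omega> = \<omega> + of_int k"
proof -
  define r where "r = sqrt (4 * of_int k + 1)"
  have "r * r = 4 * of_int k + 1"
    using k_pos by (simp add: r_def)
  then have "(1 + r) / 2 * ((1 + r) / 2) = (1 + r) / 2 + of_int k"
    by (simp add: field_simps)
  then have "complex_of_real ((1 + r) / 2 * ((1 + r) / 2)) = of_real ((1 + r) / 2 + of_int k)"
    by (simp only:)
  then show ?thesis
    unfolding \<omega>_def r_def[symmetric] by (simp only: of_real_mult of_real_add of_real_of_int_eq)
qed

lemma mult_rat:
  "(of_rat a + of_rat b * \<omega>) * (of_rat c + of_rat d * \<omega>) =
    of_rat (a * c + of_int k * b * d) + of_rat (a * d + b * c + b * d) * \<omega>"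
proof -
  have "(of_rat a + of_rat b * \<omega>) * (of_rat c + of_rat d * \<omega>) =
    of_rat a * of_rat c + (of_rat a * of_rat d + of_rat b * of_rat c) * \<omega> + of_rat b * of_rat d * (\<omega> * \<omega>)"
    by (simp add: algebra_simps)
  then show ?thesis
    unfolding omega_square by (simp add: of_rat_add of_rat_mult algebra_simps)
qed

lemma not_rat_square: "r ^ 2 \<noteq> (of_int (4 * k + 1) :: rat)"
  using squarefree_eq_if_square_multiple[of 1 "4 * k + 1" r] squarefree_disc k_pos by auto

text \<open>If \<omega> were rational, then 2 \<omega> - 1 would be a rational square root of 4
  \<open>k\<close> + 1.\<close>

lemma rat_independent:
  assumes "of_rat a + of_rat b * \<omega> = 0"
  shows "a = 0" "b = 0"
proof -
  show b: "b = 0"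
  proof (rule ccontr)
    assume "b \<noteq> 0"
    define r where "r = - a / b"
    have "of_rat b * \<omega> = - of_rat a"
      using assms by (simp add: add_eq_0_iff)
    then have r: "\<omega> = of_rat r"
      using \<open>b \<noteq> 0\<close> by (simp add: r_def of_rat_divide of_rat_minus field_simps)
    have "of_rat (r * r) = (of_rat (r + of_int k) :: complex)"
      using omega_square by (simp add: r of_rat_mult of_rat_add)
    then have "r * r = r + of_int k"
      by (simp only: of_rat_eq_iff)
    then have "(2 * r - 1) ^ 2 = of_int (4 * k + 1)"
      by (simp add: power2_eq_square algebra_simps)
    then show False
      using not_rat_square by blast
  qed
  show "a = 0"
    using assms b by simp
qed

lemma rat_coeffs_unique:
  assumes "of_rat a + of_rat b * \<omega> = of_rat c + of_rat d * \<omega>"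
  shows "a = c" "b = d"
  using rat_independent[of "a - c" "b - d"] assms by (simp_all add: of_rat_diff algebra_simps)

lemma int_coeffs_unique:
  assumes "of_int a + of_int b * \<omega> = of_int c + of_int d * \<omega>"
  shows "a = c" "b = d"
  using rat_coeffs_unique[of "of_int a" "of_int b" "of_int c" "of_int d"] assms by simp_all

lemma qfieldI: "of_rat a + of_rat b * \<omega> \<in> qfield"
  by (auto simp: qfield_def)

lemma qintI: "of_int u + of_int v * \<omega> \<in> qint"
  by (auto simp: qint_def)

lemma qint_of_int: "of_int u \<in> qint"
  using qintI[of u 0] by simp

lemma qint_add: "x \<in> qint \<Longrightarrow> y \<in> qint \<Longrightarrow> x + y \<in> qint"
proof -
  assume "x \<in> qint" "y \<in> qint"
  then obtain a b c d where "x = of_int a + of_int b * \<omega>" "y = of_int c + of_int d * \<omega>"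
    by (auto simp: qint_def)
  then have "x + y = of_int (a + c) + of_int (b + d) * \<omega>"
    by (simp add: algebra_simps)
  then show ?thesis
    by (metis qintI)
qed

lemma qint_mult: "x \<in> qint \<Longrightarrow> y \<in> qint \<Longrightarrow> x * y \<in> qint"
proof -
  assume "x \<in> qint" "y \<in> qint"
  then obtain a b c d where "x = of_int a + of_int b * \<omega>" "y = of_int c + of_int d * \<omega>"
    by (auto simp: qint_def)
  then have "x * y = of_int (a * c + k * b * d) + of_int (a * d + b * c + b * d) * \<omega>"
    using mult_rat[of "of_int a" "of_int b" "of_int c" "of_int d"] by (simp flip: of_int_mult of_int_add)
  then show ?thesis
    by (metis qintI)
qed

lemma qint_uminus: "x \<in> qint \<Longrightarrow> - x \<in> qint"
  using qint_mult[OF qint_of_int[of "-1"]] by simp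

lemma qint_power: "x \<in> qint \<Longrightarrow> x ^ n \<in> qint"
  by (induction n) (use qint_of_int[of 1] in \<open>auto intro: qint_mult\<close>)

lemma qint_sum: "(\<And>i. i \<in> S \<Longrightarrow> f i \<in> qint) \<Longrightarrow> sum f S \<in> qint"
  by (induction S rule: infinite_finite_induct) (use qint_of_int[of 0] in \<open>auto intro: qint_add\<close>)

lemma omega_qint: "\<omega> \<in> qint"
  using qintI[of 0 1] by simp

lemma qint_subset_qfield: "qint \<subseteq> qfield"
proof
  fix x assume "x \<in> qint"
  then obtain u v where "x = of_int u + of_int v * \<omega>"
    by (auto simp: qint_def)
  then show "x \<in> qfield"
    using qfieldI[of "of_int u" "of_int v"] by simp
qed

lemma subring_qint: "subring qint complex_ring"
proof -
  interpret field complex_ring by (rule complex_ring_field)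
  show ?thesis
    using qint_of_int[of 1] by (intro subringI) (auto intro: qint_add qint_mult qint_uminus)
qed

lemma subfield_qfield: "subfield qfield complex_ring"
proof -
  interpret field complex_ring by (rule complex_ring_field)
  have "subring qfield complex_ring"
  proof (rule subringI)
    show "one complex_ring \<in> qfield"
      using qfieldI[of 1 0] by simp
  next
    fix x assume "x \<in> qfield"
    then obtain a b where "x = of_rat a + of_rat b * \<omega>"
      by (auto simp: qfield_def)
    then show "a_inv complex_ring x \<in> qfield"
      using qfieldI[of "-a" "-b"] by (simp add: of_rat_minus)
  next
    fix x y assume "x \<in> qfield" "y \<in> qfield"
    then obtain a b c d where xy: "x = of_rat a + of_rat b * \<omega>" "y = of_rat c + of_rat d * \<omega>"
      by (auto simp: qfield_def)
    show "monoid.mult complex_ring x y \<in> qfield"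
      by (simp add: xy mult_rat qfieldI)
    show "add complex_ring x y \<in> qfield"
      using qfieldI[of "a + c" "b + d"] by (simp add: xy of_rat_add algebra_simps)
  qed simp
  then show ?thesis
  proof (rule subfieldI')
    fix x assume x: "x \<in> qfield - {ring.zero complex_ring}"
    then obtain a b where ab: "x = of_rat a + of_rat b * \<omega>"
      by (auto simp: qfield_def)
    \<comment> \<open>This is the norm of \<open>x\<close>, its product with the conjugate
      \<open>a\<close> + \<open>b\<close> - \<open>b\<close> \<omega>. As 4 \<open>n\<close> = (2
      \<open>a\<close> + \<open>b\<close>)^2 - \<open>b\<close>^2 (4 \<open>k\<close> + 1), it
      vanishes only if 4 \<open>k\<close> + 1 is a rational square or \<open>x\<close> is
      zero.\<close>
    define n where "n = a * a + a * b - of_int k * b * b"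
    have "n \<noteq> 0"
    proof
      assume "n = 0"
      then have sq: "(2 * a + b) ^ 2 = b ^ 2 * of_int (4 * k + 1)"
        by (simp add: n_def power2_eq_square algebra_simps)
      have "b \<noteq> 0"
        using sq x ab by auto
      then have "((2 * a + b) / b) ^ 2 = of_int (4 * k + 1)"
        using sq by (simp add: power_divide field_simps)
      then show False
        using not_rat_square by blast
    qed
    have "x * (of_rat ((a + b) / n) + of_rat (- b / n) * \<omega>) = 1"
    proof -
      have "a * ((a + b) / n) + of_int k * b * (- b / n) = 1"
        using \<open>n \<noteq> 0\<close> by (simp add: field_simps) (simp add: n_def algebra_simps)
      moreover have "a * (- b / n) + b * ((a + b) / n) + b * (- b / n) = 0"
        using \<open>n \<noteq> 0\<close> by (simp add: field_simps)
      ultimately show ?thesis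
        unfolding ab mult_rat by simp
    qed
    then have "inverse x = of_rat ((a + b) / n) + of_rat (- b / n) * \<omega>"
      by (metis inverse_unique)
    then have "inverse x \<in> qfield"
      by (metis qfieldI)
    then show "m_inv complex_ring x \<in> qfield"
      using x by (simp add: complex_ring_m_inv)
  qed
qed

text \<open>The dimension over the rationals is two: start from the zero space and extend by the
  line through 1, then by the line through the irrational \<omega>.\<close>

lemma number_field_qfield: "number_field qfield"
proof -
  interpret field complex_ring by (rule complex_ring_field)
  have Rats: "line_extension \<rat> 1 {0} = \<rat>"
    by (auto simp: line_extension_mem_iff)
  have "dimension (Suc 0) \<rat> (line_extension \<rat> 1 {0})"
    using zero_dim[of \<rat>] by (intro Suc_dim) auto
  then have "dimension (Suc 0) \<rat> \<rat>"
    by (simp only: Rats)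
  moreover have "\<omega> \<notin> \<rat>"
  proof
    assume "\<omega> \<in> \<rat>"
    then obtain r where "\<omega> = of_rat r"
      by (auto elim: Rats_cases)
    then show False
      using rat_independent(2)[of "-r" 1] by (simp add: of_rat_minus)
  qed
  ultimately have "dimension (Suc (Suc 0)) \<rat> (line_extension \<rat> \<omega> \<rat>)"
    by (intro Suc_dim) auto
  moreover have "line_extension \<rat> \<omega> \<rat> = qfield"
    by (force simp: line_extension_mem_iff qfield_def Rats_def add.commute)
  ultimately have "finite_dimension \<rat> qfield"
    by (metis finite_dimensionI)
  then show ?thesis
    using subfield_qfield by (simp add: number_field_def)
qed

section \<open>Integral elements through norm and trace\<close>

text \<open>The field norm of \<open>a\<close> + \<open>b\<close> \<omega>, as a function of the
  rational coordinates.\<close>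

definition qnorm :: "rat \<Rightarrow> rat \<Rightarrow> rat" where
  "qnorm a b = a ^ 2 + a * b - of_int k * b ^ 2"

text \<open>The norm is multiplicative; since it is defined on coordinates, the coordinates of the
  power are carried along in the induction.\<close>

lemma power_coeffs:
  "\<exists>c d. (of_rat a + of_rat b * \<omega>) ^ j = of_rat c + of_rat d * \<omega> \<and> qnorm c d = qnorm a b ^ j"
proof (induction j)
  case 0
  have "(of_rat a + of_rat b * \<omega>) ^ 0 = of_rat 1 + of_rat 0 * \<omega>" "qnorm 1 0 = qnorm a b ^ 0"
    by (simp_all add: qnorm_def)
  then show ?case by blast
next
  case (Suc j)
  then obtain c d where cd: "(of_rat a + of_rat b * \<omega>) ^ j = of_rat c + of_rat d * \<omega>"
    "qnorm c d = qnorm a b ^ j" by blast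
  have "qnorm (a * c + of_int k * b * d) (a * d + b * c + b * d) = qnorm a b * qnorm c d"
    by (simp add: qnorm_def power2_eq_square algebra_simps)
  then show ?case
    using cd mult_rat[of a b c d] by (metis power_Suc)
qed

text \<open>If \<open>D\<close> clears the denominators of all powers of an element, then
  \<open>D\<close>^2 clears those of all powers of its norm, because the norm is quadratic in the
  coordinates.\<close>

lemma qnorm_int:
  assumes "D > 0" and int: "\<And>j. of_int D * (of_rat a + of_rat b * \<omega>) ^ j \<in> qint"
  shows "qnorm a b \<in> \<int>"
proof (rule rat_int_if_powers_bounded_denom)
  show "D ^ 2 > 0"
    using assms(1) by simp
  fix j
  obtain c d where cd: "(of_rat a + of_rat b * \<omega>) ^ j = of_rat c + of_rat d * \<omega>"
    "qnorm c d = qnorm a b ^ j"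
    using power_coeffs by blast
  obtain u v where "of_int D * (of_rat a + of_rat b * \<omega>) ^ j = of_int u + of_int v * \<omega>"
    using int[of j] by (auto simp: qint_def)
  then have "of_int D * (of_rat c + of_rat d * \<omega>) = of_int u + of_int v * \<omega>"
    by (simp only: cd)
  then have "of_rat (of_int D * c) + of_rat (of_int D * d) * \<omega> = of_rat (of_int u) + of_rat (of_int v) * \<omega>"
    by (simp add: of_rat_mult algebra_simps)
  then have uv: "of_int D * c = of_int u" "of_int D * d = of_int v"
    by (rule rat_coeffs_unique)+
  have "of_int (D ^ 2) * qnorm c d = qnorm (of_int D * c) (of_int D * d)"
    by (simp add: qnorm_def power2_eq_square algebra_simps)
  also have "\<dots> \<in> \<int>"
    by (simp add: uv qnorm_def)
  finally show "of_int (D ^ 2) * qnorm a b ^ j \<in> \<int>"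
    by (simp only: cd)
qed

text \<open>A monic integral equation of degree \<open>n\<close> bounds the denominators of all powers by those of
  the first \<open>n\<close>.\<close>

lemma algebraic_int_powers_denom:
  assumes "x \<in> qfield" "algebraic_int x"
  obtains D :: int where "D > 0" "\<And>j. of_int D * x ^ j \<in> qint"
proof -
  obtain a b where ab: "x = of_rat a + of_rat b * \<omega>"
    using assms(1) by (auto simp: qfield_def)
  obtain p q p' q' where pq: "quotient_of a = (p, q)" "quotient_of b = (p', q')"
    by (metis surj_pair)
  define c where "c = q * q'"
  have q: "q > 0" "q' > 0" "a = of_int p / of_int q" "b = of_int p' / of_int q'"
    using pq quotient_of_div quotient_of_denom_pos by blast+
  then have c: "c > 0"
    by (simp add: c_def)
  have "of_int c * x = of_int (p * q') + of_int (p' * q) * \<omega>"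
    using q(1,2) by (simp add: ab q(3,4) c_def of_rat_divide field_simps)
  then have cx: "of_int c * x \<in> qint"
    by (metis qintI)
  obtain P where P: "Polynomial.lead_coeff P = 1" "\<forall>i. Polynomial.coeff P i \<in> \<int>" "poly P x = 0"
    using assms(2) by (auto elim: algebraic_int.cases)
  define n where "n = Polynomial.degree P"
  have "of_int (c ^ n) * x ^ j \<in> qint" for j
  proof (induction j rule: less_induct)
    case (less j)
    show ?case
    proof (cases "j \<le> n")
      case True
      then have "of_int (c ^ n) * x ^ j = of_int (c ^ (n - j)) * (of_int c * x) ^ j"
        by (simp add: power_mult_distrib flip: power_add mult.assoc)
      then show ?thesis
        using cx by (metis qint_mult qint_of_int qint_power)
    next
      case False
      have "0 = (\<Sum>i\<le>n. Polynomial.coeff P i * x ^ i)"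
        using P(3) by (simp add: poly_altdef n_def)
      also have "\<dots> = x ^ n + (\<Sum>i<n. Polynomial.coeff P i * x ^ i)"
        using P(1) by (simp add: n_def lessThan_Suc_atMost[symmetric])
      finally have "x ^ n = - (\<Sum>i<n. Polynomial.coeff P i * x ^ i)"
        by (simp add: eq_neg_iff_add_eq_0)
      moreover have "x ^ j = x ^ (j - n) * x ^ n"
        using False by (simp flip: power_add)
      ultimately have "of_int (c ^ n) * x ^ j = - (\<Sum>i<n. Polynomial.coeff P i * (of_int (c ^ n) * x ^ (i + (j - n))))"
        by (simp add: sum_distrib_left power_add mult_ac)
      moreover have "Polynomial.coeff P i * (of_int (c ^ n) * x ^ (i + (j - n))) \<in> qint" if "i < n" for i
      proof -
        have "Polynomial.coeff P i \<in> qint"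
          using P(2) qint_of_int by (metis Ints_cases)
        then show ?thesis
          using that False by (intro qint_mult less.IH) auto
      qed
      ultimately show ?thesis
        by (simp only:) (auto intro!: qint_uminus qint_sum)
    qed
  qed
  then show ?thesis
    using that[of "c ^ n"] c by simp
qed

text \<open>The norms of \<open>x\<close> and \<open>x + 1\<close> are integers, and their
  difference yields the trace 2 a + b. Then b^2 (4 \<open>k\<close> + 1), which is the trace squared
  minus four times the norm, is an integer, so b is one by squarefreeness, and a follows.\<close>

lemma algebraic_int_imp_qint:
  assumes "x \<in> qfield" "algebraic_int x"
  shows "x \<in> qint"
proof -
  obtain a b where ab: "x = of_rat a + of_rat b * \<omega>"
    using assms(1) by (auto simp: qfield_def)
  obtain D where D: "D > 0" "\<And>j. of_int D * x ^ j \<in> qint"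
    using algebraic_int_powers_denom[OF assms] by blast
  have n: "qnorm a b \<in> \<int>"
    using D by (intro qnorm_int[of D]) (simp_all add: ab)
  \<comment> \<open>By the binomial theorem the same \<open>D\<close> also serves for the powers of
    \<open>x + 1\<close>.\<close>
  have "of_int D * (of_rat (a + 1) + of_rat b * \<omega>) ^ j \<in> qint" for j
  proof -
    have "of_rat (a + 1) + of_rat b * \<omega> = x + 1"
      by (simp add: ab of_rat_add)
    then have "of_int D * (of_rat (a + 1) + of_rat b * \<omega>) ^ j =
        (\<Sum>i\<le>j. of_int (int (j choose i)) * (of_int D * x ^ i))"
      by (simp add: binomial_ring sum_distrib_left mult_ac)
    also have "\<dots> \<in> qint"
      by (intro qint_sum qint_mult qint_of_int D)
    finally show ?thesis .
  qed
  then have "qnorm (a + 1) b \<in> \<int>"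
    using D(1) by (rule qnorm_int[rotated])
  then have "qnorm (a + 1) b - qnorm a b - 1 \<in> \<int>"
    using n by simp
  also have "qnorm (a + 1) b - qnorm a b - 1 = 2 * a + b"
    by (simp add: qnorm_def power2_eq_square algebra_simps)
  finally have t: "2 * a + b \<in> \<int>" .
  have "(2 * a + b) ^ 2 - 4 * qnorm a b \<in> \<int>"
    using t n by simp
  also have "(2 * a + b) ^ 2 - 4 * qnorm a b = b ^ 2 * of_int (4 * k + 1)"
    by (simp add: qnorm_def power2_eq_square algebra_simps)
  finally have b: "b \<in> \<int>"
    by (rule rat_int_if_square_times_squarefree[OF squarefree_disc])
  have "qnorm a b + of_int k * b ^ 2 \<in> \<int>"
    using n b by simp
  then have "a ^ 2 + a * b \<in> \<int>"
    by (simp add: qnorm_def)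
  then have "- (a ^ 2 + a * b) \<in> \<int>"
    by (rule Ints_minus)
  \<comment> \<open>The rational number \<open>a\<close> is a root of the monic polynomial X^2 +
    \<open>b\<close> X - (\<open>a\<close>^2 + \<open>a\<close> \<open>b\<close>), whose
    coefficients are integers.\<close>
  then have "algebraic_int a"
    using b by (intro algebraic_int.intros[of "[:- (a ^ 2 + a * b), b, 1:]"])
      (auto simp: coeff_pCons split: nat.splits, simp add: power2_eq_square algebra_simps)
  then have "a \<in> \<int>"
    by (rule rational_algebraic_int_is_int) (auto simp: Rats_def)
  with b obtain u v where "a = of_int u" "b = of_int v"
    by (metis Ints_cases)
  then show ?thesis
    using qintI[of u v] by (simp add: ab)
qed

text \<open>The element is a root of X^2 - (trace) X + (norm), with trace 2 u + v.\<close>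

lemma qint_imp_algebraic_int:
  assumes "x \<in> qint"
  shows "algebraic_int x"
proof -
  obtain u v where uv: "x = of_int u + of_int v * \<omega>"
    using assms by (auto simp: qint_def)
  have "x ^ 2 = of_int u ^ 2 + 2 * of_int u * of_int v * \<omega> + of_int v ^ 2 * (\<omega> * \<omega>)"
    by (simp add: uv power2_eq_square algebra_simps)
  also have "\<dots> = of_int (2 * u + v) * x - of_int (u ^ 2 + u * v - k * v ^ 2)"
    unfolding omega_square by (simp add: uv power2_eq_square algebra_simps)
  finally have "poly [:of_int (u ^ 2 + u * v - k * v ^ 2), - of_int (2 * u + v), 1:] x = 0"
    by (simp add: power2_eq_square algebra_simps)
  then show ?thesis
    by (intro algebraic_int.intros[of "[:of_int (u ^ 2 + u * v - k * v ^ 2), - of_int (2 * u + v), 1:]"])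
      (auto simp: coeff_pCons split: nat.splits)
qed

lemma ring_of_integers_qfield: "ring_of_integers qfield = complex_ring\<lparr>carrier := qint\<rparr>"
proof -
  have "{x \<in> qfield. algebraic_int x} = qint"
    using algebraic_int_imp_qint qint_imp_algebraic_int qint_subset_qfield by blast
  then show ?thesis
    by (simp add: ring_of_integers_def)
qed

end

section \<open>Different parameters give non-isomorphic fields\<close>

text \<open>An isomorphism fixes the natural numbers, so it sends the square root of 4
  \<open>k\<close> + 1 to a square root of 4 \<open>k\<close> + 1 in the other field. That must be a
  rational multiple of the square root of 4 \<open>l\<close> + 1, and squarefreeness makes the
  discriminants equal.\<close>

lemma field_iso_qfield_imp_eq:
  assumes "real_quadratic k" "real_quadratic l"
    and iso: "field_iso (real_quadratic.qfield k) (real_quadratic.qfield l)"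
  shows "k = l"
proof -
  interpret K: real_quadratic k by fact
  interpret L: real_quadratic l by fact
  obtain h where h: "h \<in> ring_iso (complex_ring\<lparr>carrier := K.qfield\<rparr>) (complex_ring\<lparr>carrier := L.qfield\<rparr>)"
    using iso by (auto simp: field_iso_def is_ring_iso_def)
  have hom: "\<And>x y. x \<in> K.qfield \<Longrightarrow> y \<in> K.qfield \<Longrightarrow> h (x * y) = h x * h y"
    "\<And>x y. x \<in> K.qfield \<Longrightarrow> y \<in> K.qfield \<Longrightarrow> h (x + y) = h x + h y"
    "h 1 = 1" "\<And>x. x \<in> K.qfield \<Longrightarrow> h x \<in> L.qfield"
    using ring_iso_memE[OF h] by auto
  have int_mem: "of_int n \<in> K.qfield" for n
    using K.qint_of_int K.qint_subset_qfield by blast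
  have nat_mem: "of_nat n \<in> K.qfield" for n
    using int_mem[of "int n"] by simp
  have h_nat: "h (of_nat n) = of_nat n" for n
  proof (induction n)
    case 0
    have "h (0 + 0) = h 0 + h 0"
      using nat_mem[of 0] by (intro hom) simp_all
    then show ?case by simp
  next
    case (Suc n)
    then show ?case
      using hom(2)[OF nat_mem[of 1] nat_mem[of n]] hom(3) by simp
  qed
  \<comment> \<open>The square root of 4 \<open>k\<close> + 1.\<close>
  define r where "r = 2 * K.\<omega> - 1"
  have r_mem: "r \<in> K.qfield"
    using K.qfieldI[of "-1" 2] by (simp add: r_def of_rat_minus)
  have "r * r = 4 * (K.\<omega> * K.\<omega>) - 4 * K.\<omega> + 1"
    by (simp add: r_def algebra_simps)
  also have "\<dots> = of_nat (nat (4 * k + 1))"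
    unfolding K.omega_square using K.k_pos by (simp add: algebra_simps)
  finally have "h r * h r = of_nat (nat (4 * k + 1))"
    using hom(1)[OF r_mem r_mem] h_nat by metis
  then have hr: "h r * h r = of_rat (of_int (4 * k + 1)) + of_rat 0 * L.\<omega>"
    using K.k_pos by (simp add: of_rat_add of_rat_mult)
  obtain a b where ab: "h r = of_rat a + of_rat b * L.\<omega>"
    using hom(4)[OF r_mem] by (auto simp: L.qfield_def)
  have eqs: "a * a + of_int l * b * b = of_int (4 * k + 1)" "a * b + b * a + b * b = 0"
    using hr unfolding ab L.mult_rat by (rule L.rat_coeffs_unique)+
  \<comment> \<open>Otherwise 4 \<open>k\<close> + 1 would be the square of the rational
    \<open>a\<close>. The \<omega>-coordinate then gives \<open>b\<close> = -2 \<open>a\<close>,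
    that is, \<open>h r\<close> is -\<open>a\<close> times the square root of 4 \<open>l\<close> +
    1.\<close>
  have "b \<noteq> 0"
    using eqs(1) K.not_rat_square[of a] by (auto simp: power2_eq_square)
  moreover have "b * (2 * a + b) = 0"
    using eqs(2) by (simp add: algebra_simps)
  ultimately have "b = - 2 * a"
    by simp
  then have "a ^ 2 * of_int (4 * l + 1) = of_int (4 * k + 1)"
    using eqs(1) by (simp add: power2_eq_square algebra_simps)
  then have "4 * l + 1 = 4 * k + 1"
    by (rule squarefree_eq_if_square_multiple[OF L.squarefree_disc K.squarefree_disc])
  then show ?thesis
    by simp
qed

lemma iso_class_qfield_inj:
  assumes "real_quadratic k" "real_quadratic l"
    and "iso_class (real_quadratic.qfield k) = iso_class (real_quadratic.qfield l)"
  shows "k = l"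
proof -
  have "field_iso (real_quadratic.qfield l) (real_quadratic.qfield l)"
    unfolding field_iso_def is_ring_iso_def
    by (intro ex_in_conv[THEN iffD1] exI[of _ id] ring_iso_memI) auto
  then have "real_quadratic.qfield l \<in> iso_class (real_quadratic.qfield l)"
    using assms(2) by (simp add: iso_class_def real_quadratic.number_field_qfield)
  then have "field_iso (real_quadratic.qfield k) (real_quadratic.qfield l)"
    unfolding assms(3)[symmetric] by (simp add: iso_class_def)
  then show ?thesis
    using field_iso_qfield_imp_eq assms by blast
qed

subsection \<open>Ideals of the ring of integers\<close>

text \<open>Division with remainder by the least positive element. It is applied below both to the
  integers in an ideal and to the \<omega>-coordinates of its elements.\<close>

lemma int_subgroup_principal:
  fixes S :: "int set"
  assumes add: "\<And>x y. x \<in> S \<Longrightarrow> y \<in> S \<Longrightarrow> x + y \<in> S"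
    and neg: "\<And>x. x \<in> S \<Longrightarrow> - x \<in> S" and nz: "x0 \<in> S" "x0 \<noteq> 0"
  obtains c where "c > 0" "\<And>x. x \<in> S \<longleftrightarrow> c dvd x"
proof -
  define Q where "Q n \<longleftrightarrow> n > 0 \<and> int n \<in> S" for n
  have "Q (nat \<bar>x0\<bar>)"
    using nz neg[of x0] by (auto simp: Q_def abs_if)
  then have Q: "Q (LEAST n. Q n)"
    by (rule LeastI)
  define c where "c = int (LEAST n. Q n)"
  have c: "c > 0" "c \<in> S"
    using Q by (auto simp: Q_def c_def)
  have nat_mult: "int n * c \<in> S" for n
  proof (induction n)
    case 0
    then show ?case using add[OF c(2) neg[OF c(2)]] by simp
  next
    case (Suc n)
    from add[OF c(2) Suc] show ?case by (simp add: algebra_simps)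
  qed
  have mult: "z * c \<in> S" for z
    by (cases z rule: int_cases2) (use nat_mult neg in auto)
  have "c dvd x" if "x \<in> S" for x
  proof (rule ccontr)
    assume "\<not> c dvd x"
    then have pos: "x mod c > 0"
      using c by (metis dvd_eq_mod_eq_0 order_le_less pos_mod_sign)
    have "x + - (x div c) * c \<in> S"
      using that mult by (rule add)
    then have "x mod c \<in> S"
      by (simp add: minus_div_mult_eq_mod [symmetric])
    then have "Q (nat (x mod c))"
      using pos by (simp add: Q_def)
    then have "(LEAST n. Q n) \<le> nat (x mod c)"
      by (rule Least_le)
    then have "c \<le> x mod c"
      using pos by (simp add: c_def)
    then show False
      using pos_mod_bound[OF c(1), of x] by simp
  qed
  moreover have "x \<in> S" if "c dvd x" for x
    using mult that by (metis dvdE mult.commute)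
  ultimately show ?thesis
    using that c by blast
qed

section \<open>Ideals as lattices and their norms\<close>

context real_quadratic
begin

text \<open>The \<int>-span of \<open>m\<close> \<open>a\<close> and \<open>m\<close>
  (\<open>b\<close> + \<omega>), a basis in Hermite normal form.\<close>

definition lattice :: "int \<Rightarrow> int \<Rightarrow> int \<Rightarrow> complex set" where
  "lattice m a b = {of_int (m * a * x + m * b * y) + of_int (m * y) * \<omega> | x y. True}"

lemma lattice_iff:
  "of_int u + of_int v * \<omega> \<in> lattice m a b \<longleftrightarrow> (\<exists>y. v = m * y \<and> m * a dvd u - m * b * y)"
proof
  assume "of_int u + of_int v * \<omega> \<in> lattice m a b"
  then obtain x y where "of_int u + of_int v * \<omega> = of_int (m * a * x + m * b * y) + of_int (m * y) * \<omega>"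
    unfolding lattice_def by blast
  then have "u = m * a * x + m * b * y" "v = m * y"
    by (rule int_coeffs_unique)+
  then show "\<exists>y. v = m * y \<and> m * a dvd u - m * b * y"
    by auto
next
  assume "\<exists>y. v = m * y \<and> m * a dvd u - m * b * y"
  then obtain y x where "v = m * y" "u - m * b * y = m * a * x"
    by (auto elim!: dvdE)
  then have "u = m * a * x + m * b * y" "v = m * y"
    by simp_all
  then show "of_int u + of_int v * \<omega> \<in> lattice m a b"
    unfolding lattice_def by blast
qed

lemma ideal_closed:
  assumes "ideal I (ring_of_integers qfield)"
  shows "I \<subseteq> qint" "0 \<in> I" "\<And>x y. x \<in> I \<Longrightarrow> y \<in> I \<Longrightarrow> x + y \<in> I"
    "\<And>x y. x \<in> qint \<Longrightarrow> y \<in> I \<Longrightarrow> x * y \<in> I" "\<And>x. x \<in> I \<Longrightarrow> - x \<in> I"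
    "\<And>x y. x \<in> I \<Longrightarrow> y \<in> I \<Longrightarrow> x - y \<in> I"
proof -
  interpret ideal I "ring_of_integers qfield" by fact
  show "I \<subseteq> qint"
    using a_subset by (simp add: ring_of_integers_qfield)
  show "0 \<in> I"
    using additive_subgroup.zero_closed[OF is_additive_subgroup] by (simp add: ring_of_integers_qfield)
  show add: "x + y \<in> I" if "x \<in> I" "y \<in> I" for x y
    using additive_subgroup.a_closed[OF is_additive_subgroup that] by (simp add: ring_of_integers_qfield)
  show mult: "x * y \<in> I" if "x \<in> qint" "y \<in> I" for x y
    using I_l_closed[of y x] that by (simp add: ring_of_integers_qfield)
  show neg: "- x \<in> I" if "x \<in> I" for x
    using mult[OF qint_of_int[of "-1"] that] by simp
  show "x - y \<in> I" if "x \<in> I" "y \<in> I" for x y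
    using add[OF that(1) neg[OF that(2)]] by simp
qed

text \<open>The second factor is the conjugate of the first, as the conjugate of \<omega> is 1 -
  \<omega>; the right-hand side is the norm.\<close>

lemma conj_mult:
  "(of_int u + of_int v * \<omega>) * (of_int (u + v) + of_int (- v) * \<omega>) = of_int (u ^ 2 + u * v - k * v ^ 2)"
proof -
  have "(of_int u + of_int v * \<omega>) * (of_int (u + v) + of_int (- v) * \<omega>) =
      of_int (u ^ 2 + u * v) + of_int (v ^ 2) * \<omega> - of_int (v ^ 2) * (\<omega> * \<omega>)"
    by (simp add: power2_eq_square algebra_simps)
  then show ?thesis
    unfolding omega_square by (simp add: algebra_simps)
qed

lemma int_norm_nonzero:
  assumes "of_int u + of_int v * \<omega> \<noteq> 0"
  shows "u ^ 2 + u * v - k * v ^ 2 \<noteq> 0"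
proof
  assume "u ^ 2 + u * v - k * v ^ 2 = 0"
  then have "of_int (u + v) + of_int (- v) * \<omega> = 0"
    using conj_mult[of u v] assms by simp
  then have "of_int (u + v) + of_int (- v) * \<omega> = of_int 0 + of_int 0 * \<omega>"
    by simp
  then have "u + v = 0" "- v = 0"
    by (rule int_coeffs_unique)+
  then show False
    using assms by simp
qed

text \<open>The generator of the integers in the ideal, together with an element of least positive
  \<omega>-coordinate, forms a \<int>-basis. Closure under multiplication by \<omega> and by the
  conjugate of b + \<omega> gives the divisibilities.\<close>

lemma nonzero_ideal_lattice:
  assumes "I \<in> nonzero_ideals qfield"
  obtains m a b where "m > 0" "a > 0" "0 \<le> b" "b < a" "a dvd b ^ 2 + b - k" "I = lattice m a b"
proof -
  have ideal: "ideal I (ring_of_integers qfield)" and nz: "I \<noteq> {0}"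
    using assms by (auto simp: nonzero_ideals_def)
  note I = ideal_closed[OF ideal]
  obtain u0 v0 where uv0: "of_int u0 + of_int v0 * \<omega> \<in> I" "of_int u0 + of_int v0 * \<omega> \<noteq> 0"
    using nz I(1,2) unfolding qint_def by blast
  have norm_mem: "of_int (u ^ 2 + u * v - k * v ^ 2) \<in> I" if "of_int u + of_int v * \<omega> \<in> I" for u v
    using I(4)[OF qintI[of "u + v" "- v"] that] conj_mult[of u v] by (simp add: mult.commute)
  \<comment> \<open>\<open>U\<close> holds the integers of the ideal and \<open>V\<close> the
    \<omega>-coordinates of its elements; \<open>U\<close> is nonzero because it contains the norm
    of a nonzero element.\<close>
  define U where "U = {u. of_int u \<in> I}"
  define V where "V = {v. \<exists>u. of_int u + of_int v * \<omega> \<in> I}"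
  obtain c where c: "c > 0" "\<And>x. x \<in> U \<longleftrightarrow> c dvd x"
  proof (rule int_subgroup_principal)
    show "u0 ^ 2 + u0 * v0 - k * v0 ^ 2 \<in> U"
      using norm_mem[OF uv0(1)] by (simp add: U_def)
    show "u0 ^ 2 + u0 * v0 - k * v0 ^ 2 \<noteq> 0"
      using int_norm_nonzero[OF uv0(2)] .
  qed (use I(3,5) in \<open>auto simp: U_def\<close>)
  have cU: "of_int c \<in> I"
    using c(2)[of c] by (simp add: U_def)
  have "of_int 0 + of_int c * \<omega> \<in> I"
    using I(4)[OF omega_qint cU] by (simp add: mult.commute)
  then have cV: "c \<in> V"
    unfolding V_def by blast
  obtain m where m: "m > 0" "\<And>x. x \<in> V \<longleftrightarrow> m dvd x"
  proof (rule int_subgroup_principal)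
    fix x y assume "x \<in> V" "y \<in> V"
    then obtain u u' where "of_int u + of_int x * \<omega> \<in> I" "of_int u' + of_int y * \<omega> \<in> I"
      by (auto simp: V_def)
    then have "of_int (u + u') + of_int (x + y) * \<omega> \<in> I"
      using I(3) by (fastforce simp: algebra_simps)
    then show "x + y \<in> V"
      unfolding V_def by blast
  next
    fix x assume "x \<in> V"
    then obtain u where "of_int u + of_int x * \<omega> \<in> I"
      by (auto simp: V_def)
    then have "of_int (- u) + of_int (- x) * \<omega> \<in> I"
      using I(5) by fastforce
    then show "- x \<in> V"
      unfolding V_def by blast
  next
    show "c \<in> V" "c \<noteq> 0"
      using cV c by auto
  qed (use that in blast)
  obtain a where a: "c = m * a"
    using cV m(2) by (auto elim: dvdE)
  have "a > 0"
    using a c(1) m(1) by (simp add: zero_less_mult_iff)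
  obtain b0 where b0: "of_int b0 + of_int m * \<omega> \<in> I"
    using m(2)[of m] by (auto simp: V_def)
  \<comment> \<open>Multiplying the basis element by \<omega> turns its \<omega>-coordinate into
    \<open>b0 + m\<close>, so \<open>m\<close> divides \<open>b0\<close> as well.\<close>
  have "\<omega> * (of_int b0 + of_int m * \<omega>) = of_int b0 * \<omega> + of_int m * (\<omega> * \<omega>)"
    by (simp add: algebra_simps)
  also have "\<dots> = of_int (m * k) + of_int (b0 + m) * \<omega>"
    unfolding omega_square by (simp add: algebra_simps)
  finally have "of_int (m * k) + of_int (b0 + m) * \<omega> \<in> I"
    using I(4)[OF omega_qint b0] by simp
  then have "b0 + m \<in> V"
    unfolding V_def by blast
  then have "m dvd b0"
    using m(2) by simp
  then obtain b1 where b1: "b0 = m * b1"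
    by (auto elim: dvdE)
  define b where "b = b1 mod a"
  have b: "0 \<le> b" "b < a"
    using \<open>a > 0\<close> by (simp_all add: b_def)
  have gen: "of_int (m * b) + of_int m * \<omega> \<in> I"
  proof -
    have "of_int (m * a * (b1 div a)) \<in> I"
      using c(2)[of "c * (b1 div a)"] by (simp add: U_def a)
    then have "(of_int b0 + of_int m * \<omega>) - of_int (m * a * (b1 div a)) \<in> I"
      using b0 I(6) by blast
    moreover have "b0 - m * a * (b1 div a) = m * b"
      by (simp add: b1 b_def minus_mult_div_eq_mod [symmetric] algebra_simps)
    then have "(of_int b0 + of_int m * \<omega>) - of_int (m * a * (b1 div a)) = of_int (m * b) + of_int m * \<omega>"
      by (simp add: algebra_simps flip: of_int_diff of_int_mult)
    ultimately show ?thesis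
      by (simp only:)
  qed
  have "a dvd b ^ 2 + b - k"
  proof -
    \<comment> \<open>The conjugate of \<open>b\<close> + \<omega>: multiplying by it puts
      \<open>m\<close> times the norm of \<open>b\<close> + \<omega> among the integers of the
      ideal, all multiples of \<open>m\<close> \<open>a\<close>.\<close>
    have "of_int (b + 1) + of_int (- 1) * \<omega> \<in> qint"
      by (rule qintI)
    then have "(of_int (b + 1) + of_int (- 1) * \<omega>) * (of_int (m * b) + of_int m * \<omega>) \<in> I"
      using gen by (rule I(4))
    also have "(of_int (b + 1) + of_int (- 1) * \<omega>) * (of_int (m * b) + of_int m * \<omega>) =
        of_int m * ((of_int b + of_int 1 * \<omega>) * (of_int (b + 1) + of_int (- 1) * \<omega>))"
      by (simp add: algebra_simps)
    also have "\<dots> = of_int (m * (b ^ 2 + b - k))"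
      unfolding conj_mult by simp
    finally have "m * (b ^ 2 + b - k) \<in> U"
      by (simp add: U_def)
    then show ?thesis
      using c(2) m(1) by (simp add: a)
  qed
  moreover have "I = lattice m a b"
  proof
    show "lattice m a b \<subseteq> I"
    proof
      fix z assume "z \<in> lattice m a b"
      then obtain x y where z: "z = of_int (m * a * x + m * b * y) + of_int (m * y) * \<omega>"
        by (auto simp: lattice_def)
      have "of_int x * of_int c + of_int y * (of_int (m * b) + of_int m * \<omega>) \<in> I"
        by (intro I(3) I(4) qint_of_int cU gen)
      then show "z \<in> I"
        by (simp add: z a algebra_simps)
    qed
    show "I \<subseteq> lattice m a b"
    proof
      fix z assume "z \<in> I"
      then obtain u v where z: "z = of_int u + of_int v * \<omega>"
        using I(1) by (auto simp: qint_def)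
      then have "v \<in> V"
        using \<open>z \<in> I\<close> by (auto simp: V_def)
      then obtain y where y: "v = m * y"
        using m(2) by (auto elim: dvdE)
      have "z - of_int y * (of_int (m * b) + of_int m * \<omega>) \<in> I"
        by (intro I(6) I(4) \<open>z \<in> I\<close> qint_of_int gen)
      then have "u - m * b * y \<in> U"
        by (simp add: U_def z y algebra_simps)
      then show "z \<in> lattice m a b"
        unfolding z lattice_iff using c(2) y a by auto
    qed
  qed
  ultimately show ?thesis
    using that m(1) \<open>a > 0\<close> b by blast
qed

text \<open>The numbers u + v \<omega> with 0 \<le> u < \<open>m\<close> \<open>a\<close> and 0
  \<le> v < \<open>m\<close> represent each residue class exactly once.\<close>

lemma ideal_norm_lattice:
  assumes ideal: "ideal (lattice m a b) (ring_of_integers qfield)" and "m > 0" "a > 0"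
  shows "ideal_norm qfield (lattice m a b) = nat (m ^ 2 * a)"
proof -
  define J where "J = lattice m a b"
  note J = ideal_closed[OF ideal, folded J_def]
  define coset where "coset x = (\<lambda>h. h + x) ` J" for x
  have coset_eq: "coset x = coset y \<longleftrightarrow> x - y \<in> J" for x y
  proof
    assume "coset x = coset y"
    moreover have "x \<in> coset x"
      using J(2) by (force simp: coset_def)
    ultimately show "x - y \<in> J"
      by (auto simp: coset_def)
  next
    have sub: "coset x \<subseteq> coset y" if d: "x - y \<in> J" for x y
    proof
      fix z assume "z \<in> coset x"
      then obtain h where "h \<in> J" "z = h + x"
        by (auto simp: coset_def)
      then have "z = (h + (x - y)) + y" "h + (x - y) \<in> J"
        using J(3) d by auto
      then show "z \<in> coset y"
        unfolding coset_def by (rule image_eqI)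
    qed
    assume "x - y \<in> J"
    moreover then have "y - x \<in> J"
      using J(5) by fastforce
    ultimately show "coset x = coset y"
      using sub by blast
  qed
  define f where "f = (\<lambda>(u, v). coset (of_int u + of_int v * \<omega>))"
  have "bij_betw f ({0..<m * a} \<times> {0..<m}) (coset ` qint)"
  proof (rule bij_betwI')
    fix p q assume p: "p \<in> {0..<m * a} \<times> {0..<m}" and q: "q \<in> {0..<m * a} \<times> {0..<m}"
    obtain u v u' v' where uv: "p = (u, v)" "q = (u', v')"
      by fastforce
    have "u = u' \<and> v = v'" if "f p = f q"
    proof -
      have "of_int (u - u') + of_int (v - v') * \<omega> \<in> J"
        using that by (simp add: f_def uv coset_eq algebra_simps)
      then obtain y where y: "v - v' = m * y" "m * a dvd u - u' - m * b * y"
        unfolding J_def lattice_iff by blast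
      have "m dvd v - v'"
        using y by simp
      then have v: "v = v'"
        using p q uv by (metis SigmaE2 atLeastLessThan_iff mod_eq_dvd_iff mod_pos_pos_trivial)
      then have "y = 0"
        using y(1) assms(2) by simp
      then have "m * a dvd u - u'"
        using y(2) by simp
      then have "u = u'"
        using p q uv by (metis SigmaE2 atLeastLessThan_iff mod_eq_dvd_iff mod_pos_pos_trivial)
      then show ?thesis
        using v by simp
    qed
    then show "f p = f q \<longleftrightarrow> p = q"
      using uv by auto
  next
    fix p assume "p \<in> {0..<m * a} \<times> {0..<m}"
    then show "f p \<in> coset ` qint"
      by (auto simp: f_def qintI)
  next
    fix Z assume "Z \<in> coset ` qint"
    then obtain u v where Z: "Z = coset (of_int u + of_int v * \<omega>)"
      by (auto simp: qint_def)
    \<comment> \<open>Reduce the \<omega>-coordinate first, subtracting \<open>y\<close> times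
      \<open>m\<close> (\<open>b\<close> + \<omega>); what is left of the integer coordinate is then
      reduced modulo \<open>m\<close> \<open>a\<close>.\<close>
    define y where "y = v div m"
    define v' where "v' = v mod m"
    define u' where "u' = (u - m * b * y) mod (m * a)"
    have "m * a dvd u - m * b * y - u'"
      unfolding u'_def by simp
    then have "m * a dvd (u - u') - m * b * y"
      by (simp add: algebra_simps)
    moreover have "v - v' = m * y"
      by (simp add: v'_def y_def minus_mod_eq_mult_div)
    ultimately have "of_int (u - u') + of_int (v - v') * \<omega> \<in> J"
      unfolding J_def lattice_iff by blast
    then have "Z = f (u', v')"
      unfolding Z f_def by (simp add: coset_eq algebra_simps)
    moreover have "(u', v') \<in> {0..<m * a} \<times> {0..<m}"
      using assms by (simp add: u'_def v'_def)
    ultimately show "\<exists>p\<in>{0..<m * a} \<times> {0..<m}. Z = f p"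
      by blast
  qed
  then have "card (coset ` qint) = card ({0..<m * a} \<times> {0..<m})"
    using bij_betw_same_card by fastforce
  also have "\<dots> = nat (m ^ 2 * a)"
    using assms by (simp add: card_cartesian_product nat_mult_distrib power2_eq_square mult_ac)
  also have "coset ` qint = carrier (ring_of_integers qfield Quot J)"
    by (auto simp: FactRing_def A_RCOSETS_def' a_r_coset_def' coset_def ring_of_integers_qfield)
  finally show ?thesis
    by (simp add: ideal_norm_def J_def)
qed

lemma lattice_one: "lattice 1 1 0 = qint"
proof -
  have "lattice 1 1 0 \<subseteq> qint"
    unfolding lattice_def using qintI by blast
  moreover have "qint \<subseteq> lattice 1 1 0"
    by (auto simp: qint_def lattice_iff)
  ultimately show ?thesis by blast
qed

lemma qint_nonzero_ideal: "qint \<in> nonzero_ideals qfield"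
proof -
  interpret field complex_ring by (rule complex_ring_field)
  have "ring (complex_ring\<lparr>carrier := qint\<rparr>)"
    by (rule subring_is_ring[OF subring_qint])
  then have "ideal qint (ring_of_integers qfield)"
    unfolding ring_of_integers_qfield using ring.oneideal by fastforce
  moreover have "1 \<in> qint"
    using qint_of_int[of 1] by simp
  then have "qint \<noteq> {0}"
    by (metis singletonD zero_neq_one)
  ultimately show ?thesis
    by (simp add: nonzero_ideals_def)
qed

end

subsection \<open>The majorising series\<close>

text \<open>Triples with a zero entry contribute nothing, since \<open>0 powr x = 0\<close>.\<close>

definition triple_term :: "real \<Rightarrow> nat \<times> nat \<times> nat \<Rightarrow> real" where
  "triple_term \<sigma> = (\<lambda>(m, u, v). real (m ^ 2 * u * v) powr - \<sigma>)"

lemma triple_term_nonneg: "triple_term \<sigma> t \<ge> 0"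
  by (cases t) (simp add: triple_term_def)

lemma triple_term_eq:
  "triple_term \<sigma> (m, u, v) = real m powr - (2 * \<sigma>) * (real u powr - \<sigma> * real v powr - \<sigma>)"
proof -
  have "real m powr - (2 * \<sigma>) = (real m ^ 2) powr - \<sigma>"
    by (cases "m = 0") (simp_all add: powr_powr flip: powr_numeral)
  then show ?thesis
    by (simp add: triple_term_def powr_mult)
qed

lemma norm_of_nat_powr: "norm (of_nat n powr z :: complex) = real n powr Re z"
  by (cases "n = 0") (simp_all add: norm_powr_real_powr)

lemma summable_on_powr:
  fixes \<sigma> :: real
  assumes "\<sigma> > 1"
  shows "(\<lambda>n::nat. real n powr - \<sigma>) summable_on UNIV"
  using assms by (intro summable_nonneg_imp_summable_on) (auto simp: summable_real_powr_iff)

lemma summable_on_prod_nonneg: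
  fixes f :: "'a \<Rightarrow> real" and g :: "'b \<Rightarrow> real"
  assumes "f summable_on A" "g summable_on B" "\<And>x. f x \<ge> 0" "\<And>y. g y \<ge> 0"
  shows "(\<lambda>(x, y). f x * g y) summable_on A \<times> B"
proof (rule summable_on_SigmaI)
  show "((\<lambda>y. case (x, y) of (x, y) \<Rightarrow> f x * g y) has_sum (f x * infsum g B)) B" for x
    using assms(2) by (auto intro!: has_sum_cmult_right)
  show "(\<lambda>x. f x * infsum g B) summable_on A"
    using assms(1) by (rule summable_on_cmult_left)
qed (use assms in auto)

text \<open>The sum over all triples factors as \<zeta>(2\<sigma>) \<zeta>(\<sigma>)^2.\<close>

lemma summable_on_triple_term:
  assumes "\<sigma> > 1"
  shows "triple_term \<sigma> summable_on UNIV"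
proof -
  have "(\<lambda>(u::nat, v::nat). real u powr - \<sigma> * real v powr - \<sigma>) summable_on UNIV \<times> UNIV"
    using assms by (intro summable_on_prod_nonneg summable_on_powr) auto
  then have "(\<lambda>(m::nat, p). real m powr - (2 * \<sigma>) * (case p of (u::nat, v::nat) \<Rightarrow> real u powr - \<sigma> * real v powr - \<sigma>))
      summable_on UNIV \<times> UNIV \<times> UNIV"
    using assms by (intro summable_on_prod_nonneg summable_on_powr) auto
  moreover have "triple_term \<sigma> =
      (\<lambda>(m, p). real m powr - (2 * \<sigma>) * (case p of (u, v) \<Rightarrow> real u powr - \<sigma> * real v powr - \<sigma>))"
    by (auto simp: fun_eq_iff triple_term_eq)
  ultimately show ?thesis
    by simp
qed

section \<open>Zeta values and tail estimates\<close>

lemma riemann_zeta_split: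
  assumes "\<sigma> > 1"
  shows "riemann_zeta \<sigma> = 1 + (\<Sum>n. real (n + 2) powr - \<sigma>)"
proof -
  have "summable (\<lambda>n. real n powr - \<sigma>)"
    using assms by (simp add: summable_real_powr_iff)
  then have "summable (\<lambda>n. real (Suc n) powr - \<sigma>)"
    by (rule summable_Suc_iff[THEN iffD2])
  then have "(\<Sum>n. real (Suc n) powr - \<sigma>) = (\<Sum>n. real (Suc (Suc n)) powr - \<sigma>) + real (Suc 0) powr - \<sigma>"
    by (subst suminf_split_head) auto
  then show ?thesis
    by (simp add: riemann_zeta_def powr_minus_divide)
qed

text \<open>The series is \<zeta>(2\<sigma>) - 1. It is at most \<zeta>(2) - 1 = \<pi>^2/6 - 1 < 1,
  and termwise it lies strictly below \<zeta>(\<sigma>) - 1. Strictness leaves room for a small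
  tail.\<close>

lemma square_series_bounds:
  assumes "\<sigma> > 1"
  shows "(\<Sum>n. real (n + 2) powr - (2 * \<sigma>)) < 1"
    and "1 + (\<Sum>n. real (n + 2) powr - (2 * \<sigma>)) < riemann_zeta \<sigma>"
proof -
  have summable: "summable (\<lambda>n. real (n + 2) powr - s)" if "s > 1" for s
    using that by (subst summable_iff_shift) (simp add: summable_real_powr_iff)
  have "(\<lambda>n. 1 / real (n + 1) ^ 2) sums (pi ^ 2 / 6 - 1 + 1 / real (0 + 1) ^ 2)"
    using inverse_squares_sums by simp
  then have "(\<lambda>n. 1 / real (Suc n + 1) ^ 2) sums (pi ^ 2 / 6 - 1)"
    by (rule sums_Suc_iff[THEN iffD2])
  then have sq: "(\<lambda>n. 1 / real (n + 2) ^ 2) sums (pi ^ 2 / 6 - 1)"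
    by (simp add: add_ac)
  have "(\<Sum>n. real (n + 2) powr - (2 * \<sigma>)) \<le> (\<Sum>n. 1 / real (n + 2) ^ 2)"
  proof (rule suminf_le)
    fix n
    have "real (n + 2) powr - (2 * \<sigma>) \<le> real (n + 2) powr - 2"
      using assms by (intro powr_mono) auto
    also have "\<dots> = 1 / real (n + 2) ^ 2"
      by (simp add: powr_minus_divide powr_numeral)
    finally show "real (n + 2) powr - (2 * \<sigma>) \<le> 1 / real (n + 2) ^ 2" .
  qed (use summable[of "2 * \<sigma>"] assms sq in \<open>auto simp: sums_iff\<close>)
  also have "\<dots> = pi ^ 2 / 6 - 1"
    using sq by (simp add: sums_iff)
  also have "\<dots> < 1"
  proof -
    \<comment> \<open>The claim amounts to \<pi>^2 < 12, and (16/5)^2 = 10.24.\<close>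
    have "pi ^ 2 \<le> (16 / 5) ^ 2"
      using pi_approx(2) by (intro power_mono) auto
    then show ?thesis
      by (simp add: power2_eq_square)
  qed
  finally show "(\<Sum>n. real (n + 2) powr - (2 * \<sigma>)) < 1" .
  have "(\<Sum>n. real (n + 2) powr - \<sigma> - real (n + 2) powr - (2 * \<sigma>)) > 0"
    using assms summable[of \<sigma>] summable[of "2 * \<sigma>"] by (intro suminf_pos summable_diff) auto
  also have "(\<Sum>n. real (n + 2) powr - \<sigma> - real (n + 2) powr - (2 * \<sigma>)) =
      (\<Sum>n. real (n + 2) powr - \<sigma>) - (\<Sum>n. real (n + 2) powr - (2 * \<sigma>))"
    using assms summable[of \<sigma>] summable[of "2 * \<sigma>"] by (intro suminf_diff[symmetric]) auto
  finally show "1 + (\<Sum>n. real (n + 2) powr - (2 * \<sigma>)) < riemann_zeta \<sigma>"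
    using assms by (simp add: riemann_zeta_split)
qed

text \<open>A finite set of triples carries the whole sum up to \<delta>, and a set with all
  products \<open>u * v\<close> large enough avoids it.\<close>

lemma infsum_triple_term_tail:
  assumes "\<sigma> > 1" "\<delta> > 0"
  obtains N :: nat where "\<And>T. (\<And>m u v. (m, u, v) \<in> T \<Longrightarrow> u * v > N) \<Longrightarrow> infsum (triple_term \<sigma>) T \<le> \<delta>"
proof -
  define S where "S = infsum (triple_term \<sigma>) UNIV"
  note summable = summable_on_triple_term[OF assms(1)]
  have summable_sub: "triple_term \<sigma> summable_on T" for T
    using summable_on_subset_banach[OF summable] by blast
  have S: "(triple_term \<sigma> has_sum S) UNIV"
    unfolding S_def using summable by (rule has_sum_infsum)
  then have "\<forall>\<^sub>F F in finite_subsets_at_top UNIV. dist (sum (triple_term \<sigma>) F) S < \<delta>"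
    using assms(2) by (simp add: has_sum_def tendsto_iff)
  then obtain F where F: "finite F" "dist (sum (triple_term \<sigma>) F) S < \<delta>"
    by (auto simp: eventually_finite_subsets_at_top)
  \<comment> \<open>The sum serves as an upper bound for each single product \<open>u * v\<close>
    over \<open>F\<close>.\<close>
  define N where "N = (\<Sum>(m, u, v)\<in>F. u * v)"
  have "infsum (triple_term \<sigma>) T \<le> \<delta>" if T: "\<And>m u v. (m, u, v) \<in> T \<Longrightarrow> u * v > N" for T
  proof -
    have "T \<inter> F = {}"
    proof (rule ccontr)
      assume "T \<inter> F \<noteq> {}"
      then obtain m u v where muv: "(m, u, v) \<in> T" "(m, u, v) \<in> F"
        by auto
      then have "u * v \<le> N"
        unfolding N_def using member_le_sum[of "(m, u, v)" F "\<lambda>(m, u, v). u * v"] F(1) by auto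
      then show False
        using T[OF muv(1)] by simp
    qed
    then have "infsum (triple_term \<sigma>) T \<le> infsum (triple_term \<sigma>) (UNIV - F)"
      by (intro infsum_mono2 summable_sub) (auto simp: triple_term_nonneg)
    also have "\<dots> = S - sum (triple_term \<sigma>) F"
      using F(1) S by (intro infsumI has_sum_Diff has_sum_finite) auto
    also have "\<dots> \<le> \<delta>"
      using F(2) by (simp add: dist_real_def)
    finally show ?thesis .
  qed
  then show ?thesis
    using that by blast
qed

text \<open>Such a \<open>T\<close> consists of triples (m, 1, 1) with m \<ge> 2, contributing at
  most \<zeta>(2\<sigma>) - 1, and of triples with \<open>u * v > N\<close>, contributing an
  arbitrarily small amount. The first bound will give nonvanishing of the Dedekind series, the
  second its size.\<close>

lemma infsum_triple_term_bounds:
  assumes "\<sigma> > 1"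
  obtains N :: nat where
    "\<And>T. (1, 1, 1) \<notin> T \<Longrightarrow> (\<And>m u v. (m, u, v) \<in> T \<Longrightarrow> m > 0 \<and> (u * v = 1 \<or> u * v > N)) \<Longrightarrow>
      infsum (triple_term \<sigma>) T < 1 \<and> 1 + infsum (triple_term \<sigma>) T \<le> (riemann_zeta \<sigma>) ^ 2"
proof -
  define Z where "Z = (\<Sum>n. real (n + 2) powr - (2 * \<sigma>))"
  have Z: "Z < 1" "1 + Z < riemann_zeta \<sigma>"
    unfolding Z_def using square_series_bounds[OF assms] by blast+
  have "Z \<ge> 0"
    unfolding Z_def using assms
    by (intro suminf_nonneg, subst summable_iff_shift) (auto simp: summable_real_powr_iff)
  then have "riemann_zeta \<sigma> \<le> (riemann_zeta \<sigma>) ^ 2"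
    using Z(2) by (intro self_le_power) auto
  \<comment> \<open>Half of the smaller of the two gaps left by \<open>Z\<close>.\<close>
  define \<delta> where "\<delta> = min (1 - Z) (riemann_zeta \<sigma> - 1 - Z) / 2"
  have \<delta>: "\<delta> > 0" "Z + \<delta> < 1" "1 + Z + \<delta> \<le> riemann_zeta \<sigma>"
  proof -
    show "\<delta> > 0"
      using Z by (simp add: \<delta>_def)
    have d: "\<delta> \<le> (1 - Z) / 2" "\<delta> \<le> (riemann_zeta \<sigma> - 1 - Z) / 2"
      by (simp_all add: \<delta>_def)
    show "Z + \<delta> < 1"
      using d(1) Z(1) by (simp add: field_simps)
    show "1 + Z + \<delta> \<le> riemann_zeta \<sigma>"
      using d(2) Z(2) by (simp add: field_simps)
  qed
  obtain N where N: "\<And>T. (\<And>m u v. (m, u, v) \<in> T \<Longrightarrow> u * v > N) \<Longrightarrow> infsum (triple_term \<sigma>) T \<le> \<delta>"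
    using infsum_triple_term_tail[OF assms \<delta>(1)] by blast
  have summable_sub: "triple_term \<sigma> summable_on T" for T
    using summable_on_subset_banach[OF summable_on_triple_term[OF assms]] by blast
  have bound: "infsum (triple_term \<sigma>) T \<le> Z + \<delta>"
    if "(1, 1, 1) \<notin> T" and T: "\<And>m u v. (m, u, v) \<in> T \<Longrightarrow> m > 0 \<and> (u * v = 1 \<or> u * v > N)" for T
  proof -
    \<comment> \<open>The index starts at m = 2, since m is positive and (1, 1, 1) is
      excluded.\<close>
    define h :: "nat \<Rightarrow> nat \<times> nat \<times> nat" where "h n = (n + 2, 1, 1)" for n
    define T1 where "T1 = T \<inter> range h"
    define T2 where "T2 = T - range h"
    have "((triple_term \<sigma> \<circ> h) has_sum Z) UNIV"
    proof (rule sums_nonneg_imp_has_sum)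
      have "summable (\<lambda>n. real (n + 2) powr - (2 * \<sigma>))"
        using assms by (subst summable_iff_shift) (simp add: summable_real_powr_iff)
      then have "(\<lambda>n. real (n + 2) powr - (2 * \<sigma>)) sums Z"
        unfolding Z_def by (rule summable_sums)
      then show "(triple_term \<sigma> \<circ> h) sums Z"
        by (simp add: h_def triple_term_eq o_def)
    qed (simp add: triple_term_nonneg)
    moreover have "inj h"
      by (auto simp: h_def inj_on_def)
    ultimately have "(triple_term \<sigma> has_sum Z) (range h)"
      by (simp add: has_sum_reindex)
    then have "infsum (triple_term \<sigma>) (range h) = Z"
      by (rule infsumI)
    moreover have "infsum (triple_term \<sigma>) T1 \<le> infsum (triple_term \<sigma>) (range h)"
      by (intro infsum_mono2 summable_sub) (auto simp: T1_def triple_term_nonneg)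
    moreover have "infsum (triple_term \<sigma>) T2 \<le> \<delta>"
    proof (rule N)
      fix m u v assume muv: "(m, u, v) \<in> T2"
      show "u * v > N"
      proof (rule ccontr)
        assume "\<not> u * v > N"
        then have "m > 0" "u = 1" "v = 1"
          using T[of m u v] muv by (auto simp: T2_def)
        moreover have "m \<noteq> 1"
          using that(1) muv calculation by (auto simp: T2_def)
        ultimately have "(m, u, v) = h (m - 2)"
          by (simp add: h_def)
        then show False
          using muv by (auto simp: T2_def)
      qed
    qed
    moreover have "infsum (triple_term \<sigma>) (T1 \<union> T2) = infsum (triple_term \<sigma>) T1 + infsum (triple_term \<sigma>) T2"
      by (intro infsum_Un_disjoint summable_sub) (auto simp: T1_def T2_def)
    moreover have "T1 \<union> T2 = T"
      by (auto simp: T1_def T2_def)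
    ultimately show ?thesis
      by simp
  qed
  show ?thesis
  proof (rule that)
    fix T :: "(nat \<times> nat \<times> nat) set" assume T: "(1, 1, 1) \<notin> T" "\<And>m u v. (m, u, v) \<in> T \<Longrightarrow> m > 0 \<and> (u * v = 1 \<or> u * v > N)"
    have "infsum (triple_term \<sigma>) T \<le> Z + \<delta>"
      by (rule bound) (use T in blast)+
    then show "infsum (triple_term \<sigma>) T < 1 \<and> 1 + infsum (triple_term \<sigma>) T \<le> (riemann_zeta \<sigma>) ^ 2"
      using \<delta> \<open>riemann_zeta \<sigma> \<le> (riemann_zeta \<sigma>) ^ 2\<close> by linarith
  qed
qed

section \<open>The first Laurent coefficient at a point of nonvanishing\<close>

text \<open>At a point where the series is holomorphic and nonzero, the Laurent expansion is the
  Taylor expansion and its first nonzero coefficient is the value. Every admissible continuation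
  agrees with the series near \<open>s\<close>, so the description is unique.\<close>

lemma dedekind_zeta_star_eq:
  assumes holo: "dedekind_series K holomorphic_on {z. Re z > 1}"
    and "Re s > 1" and nz: "dedekind_series K s \<noteq> 0"
  shows "dedekind_zeta_star K s = dedekind_series K s"
proof -
  define D where "D = dedekind_series K"
  have op: "open {z. Re z > 1}"
    by (rule open_halfspace_Re_gt)
  have an: "D analytic_on {s}"
    using holo op assms(2) unfolding D_def analytic_at by blast
  define F where "F = fps_to_fls (fps_expansion D s)"
  have lau: "(\<lambda>w. D (s + w)) has_laurent_expansion F"
    unfolding F_def using an analytic_at_imp_has_fps_expansion has_laurent_expansion_fps by blast
  have val: "fls_nth F (fls_subdegree F) = D s"
  proof -
    have "fps_nth (fps_expansion D s) 0 = D s"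
      by (simp add: fps_expansion_def)
    moreover then have "subdegree (fps_expansion D s) = 0"
      using nz by (simp add: D_def)
    ultimately show ?thesis
      by (simp add: F_def fls_subdegree_fls_to_fps)
  qed
  have "(THE a. \<exists>c f F. c < Re s \<and> is_dedekind_zeta_on K c f \<and>
     (\<lambda>w. f (s + w)) has_laurent_expansion F \<and> a = fls_nth F (fls_subdegree F)) = D s"
  proof (rule the_equality)
    \<comment> \<open>For existence the half-plane of convergence, with c = 1, suffices.\<close>
    have "is_dedekind_zeta_on K 1 D"
      using holo op by (auto simp: is_dedekind_zeta_on_def D_def intro!: analytic_on_imp_meromorphic_on
          simp flip: analytic_on_open)
    then show "\<exists>c f F. c < Re s \<and> is_dedekind_zeta_on K c f \<and>
     (\<lambda>w. f (s + w)) has_laurent_expansion F \<and> D s = fls_nth F (fls_subdegree F)"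
      using lau val assms(2) by metis
  next
    fix a
    assume "\<exists>c f F. c < Re s \<and> is_dedekind_zeta_on K c f \<and>
     (\<lambda>w. f (s + w)) has_laurent_expansion F \<and> a = fls_nth F (fls_subdegree F)"
    then obtain c f G where fG: "is_dedekind_zeta_on K c f"
      "(\<lambda>w. f (s + w)) has_laurent_expansion G" "a = fls_nth G (fls_subdegree G)"
      by blast
    have "eventually (\<lambda>z. z \<in> {z. Re z > 1}) (at s)"
      using op assms(2) by (intro eventually_at_in_open') auto
    then have "eventually (\<lambda>z. f z = D z) (at s)"
      by eventually_elim (use fG(1) in \<open>auto simp: is_dedekind_zeta_on_def D_def\<close>)
    then have "(\<lambda>w. D (s + w)) has_laurent_expansion G"
      using fG(2) has_laurent_expansion_cong' by blast
    then have "G = F"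
      using lau has_laurent_expansion_unique by blast
    then show "a = D s"
      using fG(3) val by simp
  qed
  then show ?thesis
    by (simp add: dedekind_zeta_star_def D_def)
qed

subsection \<open>Dedekind zeta functions of quadratic fields\<close>

context real_quadratic
begin

text \<open>An ideal with data (m, a, b) goes to (m, g, a/g), where g = gcd(a, b - b') for a
  reference root b' modulo a. The triple returns m and a, and then g fixes b modulo a by
  \<open>root_eq_of_gcd_eq\<close>.\<close>

lemma ideal_triples:
  obtains \<phi> :: "complex set \<Rightarrow> nat \<times> nat \<times> nat" where "inj_on \<phi> (nonzero_ideals qfield)"
    "\<And>I m u v. I \<in> nonzero_ideals qfield \<Longrightarrow> \<phi> I = (m, u, v) \<Longrightarrow>
      m > 0 \<and> ideal_norm qfield I = m ^ 2 * u * v \<and> u * v > 0 \<and> (\<exists>b. int (u * v) dvd b ^ 2 + b - k)"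
proof -
  define Q where "Q I t \<longleftrightarrow> (case t of (m, a, b) \<Rightarrow> m > 0 \<and> a > 0 \<and> 0 \<le> b \<and> b < a \<and>
      a dvd b ^ 2 + b - k \<and> I = lattice m a b)" for I t
  define h where "h I = (SOME t. Q I t)" for I
  define M where "M I = fst (h I)" for I
  define A where "A I = fst (snd (h I))" for I
  define Bf where "Bf I = snd (snd (h I))" for I
  have MAB: "M I > 0 \<and> A I > 0 \<and> 0 \<le> Bf I \<and> Bf I < A I \<and> A I dvd (Bf I) ^ 2 + Bf I - k"
    and I_eq: "lattice (M I) (A I) (Bf I) = I" if I: "I \<in> nonzero_ideals qfield" for I
  proof -
    obtain m a b where "m > 0" "a > 0" "0 \<le> b" "b < a" "a dvd b ^ 2 + b - k" "I = lattice m a b"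
      by (rule nonzero_ideal_lattice[OF I])
    then have "Q I (m, a, b)"
      by (simp add: Q_def)
    then have "Q I (h I)"
      unfolding h_def by (rule someI)
    then show "M I > 0 \<and> A I > 0 \<and> 0 \<le> Bf I \<and> Bf I < A I \<and> A I dvd (Bf I) ^ 2 + Bf I - k"
      "lattice (M I) (A I) (Bf I) = I"
      by (auto simp: Q_def M_def A_def Bf_def case_prod_unfold)
  qed
  \<comment> \<open>The reference root depends on the modulus alone, so ideals with equal
    \<open>A\<close> are compared with the same root.\<close>
  define r where "r a = (SOME b. a dvd b ^ 2 + b - k)" for a
  have r: "A I dvd (r (A I)) ^ 2 + r (A I) - k" if "I \<in> nonzero_ideals qfield" for I
  proof -
    have "\<exists>b. A I dvd b ^ 2 + b - k"
      using MAB[OF that] by blast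
    then show ?thesis
      unfolding r_def by (rule someI_ex)
  qed
  define g where "g I = gcd (A I) (Bf I - r (A I))" for I
  have g: "g I > 0" "A I = g I * (A I div g I)" "A I div g I > 0" if "I \<in> nonzero_ideals qfield" for I
  proof -
    show "g I > 0"
      using MAB[OF that] by (simp add: g_def)
    show eq: "A I = g I * (A I div g I)"
      by (simp add: g_def)
    have "g I * (A I div g I) > 0"
      using MAB[OF that] by (simp add: g_def)
    then show "A I div g I > 0"
      using \<open>g I > 0\<close> by (simp add: zero_less_mult_iff)
  qed
  define \<phi> where "\<phi> I = (nat (M I), nat (g I), nat (A I div g I))" for I
  have "inj_on \<phi> (nonzero_ideals qfield)"
  proof (rule inj_onI)
    fix I J assume I: "I \<in> nonzero_ideals qfield" and J: "J \<in> nonzero_ideals qfield" and eq: "\<phi> I = \<phi> J"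
    have M: "M I = M J" and G: "g I = g J" and Q: "A I div g I = A J div g J"
      using eq MAB[OF I] MAB[OF J] g(1,3)[OF I] g(1,3)[OF J]
      by (auto simp: \<phi>_def eq_nat_nat_iff)
    have A: "A I = A J"
      using g(2)[OF I] g(2)[OF J] G Q by metis
    have "A I dvd Bf I - Bf J"
    proof (rule root_eq_of_gcd_eq[OF _ squarefree_disc])
      show "A I dvd (r (A I)) ^ 2 + r (A I) - k"
        by (rule r[OF I])
      show "gcd (A I) (Bf I - r (A I)) = gcd (A I) (Bf J - r (A I))"
        using G by (simp add: g_def A)
    qed (use MAB[OF I] MAB[OF J] A in auto)
    then have "Bf I = Bf J"
      using MAB[OF I] MAB[OF J] A by (metis mod_eq_dvd_iff mod_pos_pos_trivial)
    then show "I = J"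
      using I_eq[OF I] I_eq[OF J] M A by metis
  qed
  moreover have "m > 0 \<and> ideal_norm qfield I = m ^ 2 * u * v \<and> u * v > 0 \<and> (\<exists>b. int (u * v) dvd b ^ 2 + b - k)"
    if I: "I \<in> nonzero_ideals qfield" and "\<phi> I = (m, u, v)" for I m u v
  proof -
    have muv: "M I = int m" "g I = int u" "A I div g I = int v"
      using that(2) MAB[OF I] g(1,3)[OF I] by (auto simp: \<phi>_def)
    have A: "A I = int (u * v)"
      using g(2)[OF I] muv by (metis of_nat_mult)
    have "ideal (lattice (M I) (A I) (Bf I)) (ring_of_integers qfield)"
      using I by (simp add: I_eq nonzero_ideals_def)
    then have "ideal_norm qfield I = nat ((M I) ^ 2 * A I)"
      using MAB[OF I] I_eq[OF I] ideal_norm_lattice by metis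
    also have "\<dots> = nat (int (m ^ 2 * u * v))"
      by (simp add: muv A)
    finally have "ideal_norm qfield I = m ^ 2 * u * v"
      by (simp only: nat_int)
    then show ?thesis
      using MAB[OF I] A muv by (metis of_nat_0_less_iff)
  qed
  ultimately show ?thesis
    using that by blast
qed

lemma ideal_norm_qint: "ideal_norm qfield qint = 1"
  using ideal_norm_lattice[of 1 1 0] qint_nonzero_ideal by (simp add: lattice_one nonzero_ideals_def)

text \<open>Weierstrass test on discs: the injection of ideals into triples turns the convergent
  triple series into a majorant.\<close>

lemma dedekind_series_holomorphic: "dedekind_series qfield holomorphic_on {z. Re z > 1}"
proof -
  obtain \<phi> where inj: "inj_on \<phi> (nonzero_ideals qfield)"
    and \<phi>: "\<And>I m u v. I \<in> nonzero_ideals qfield \<Longrightarrow> \<phi> I = (m, u, v) \<Longrightarrow>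
      m > 0 \<and> ideal_norm qfield I = m ^ 2 * u * v \<and> u * v > 0 \<and> (\<exists>b. int (u * v) dvd b ^ 2 + b - k)"
    using ideal_triples by blast
  have "dedekind_series qfield analytic_on {z. Re z > 1}"
    unfolding analytic_on_def
  proof
    fix z0 :: complex assume "z0 \<in> {z. Re z > 1}"
    \<comment> \<open>Half the distance from \<open>z0\<close> to the line Re z = 1, so that Re z
      \<ge> 1 + \<open>r\<close> on the closed disc.\<close>
    define r where "r = (Re z0 - 1) / 2"
    have r: "r > 0" "1 + r > 1"
      using \<open>z0 \<in> {z. Re z > 1}\<close> by (simp_all add: r_def)
    have "uniform_limit (cball z0 r) (\<lambda>S z. \<Sum>I\<in>S. of_nat (ideal_norm qfield I) powr - z)
        (\<lambda>z. \<Sum>\<^sub>\<infinity>I\<in>nonzero_ideals qfield. of_nat (ideal_norm qfield I) powr - z)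
        (finite_subsets_at_top (nonzero_ideals qfield))"
    proof (rule Weierstrass_m_test_general)
      show "(triple_term (1 + r) \<circ> \<phi>) summable_on nonzero_ideals qfield"
        using summable_on_subset_banach[OF summable_on_triple_term[OF r(2)]] inj
        by (subst summable_on_reindex[symmetric]) auto
      fix I z assume I: "I \<in> nonzero_ideals qfield" and z: "z \<in> cball z0 r"
      have "\<bar>Re (z0 - z)\<bar> \<le> r"
        using z abs_Re_le_cmod[of "z0 - z"] by (simp add: dist_norm)
      then have "Re z \<ge> 1 + r"
        by (simp add: r_def abs_le_iff) argo
      obtain m u v where muv: "\<phi> I = (m, u, v)"
        by (metis prod_cases3)
      have n: "ideal_norm qfield I = m ^ 2 * u * v" "ideal_norm qfield I > 0"
        using \<phi>[OF I muv] by (simp_all add: mult.assoc)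
      have "norm (of_nat (ideal_norm qfield I) powr - z :: complex) = real (ideal_norm qfield I) powr - Re z"
        by (simp add: norm_of_nat_powr)
      also have "\<dots> \<le> real (ideal_norm qfield I) powr - (1 + r)"
        using \<open>Re z \<ge> 1 + r\<close> n(2) by (intro powr_mono) auto
      also have "\<dots> = (triple_term (1 + r) \<circ> \<phi>) I"
        by (simp add: triple_term_def muv n(1))
      finally show "norm (of_nat (ideal_norm qfield I) powr - z :: complex) \<le> (triple_term (1 + r) \<circ> \<phi>) I" .
    qed
    then have lim: "uniform_limit (cball z0 r) (\<lambda>S z. \<Sum>I\<in>S. of_nat (ideal_norm qfield I) powr - z)
        (dedekind_series qfield) (finite_subsets_at_top (nonzero_ideals qfield))"
      by (simp add: dedekind_series_def[abs_def])
    have "(\<lambda>z. \<Sum>I\<in>S. of_nat (ideal_norm qfield I) powr - z :: complex) holomorphic_on UNIV" for S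
      by (intro holomorphic_intros)
    then have partial: "continuous_on (cball z0 r) (\<lambda>z. \<Sum>I\<in>S. of_nat (ideal_norm qfield I) powr - z :: complex) \<and>
        (\<lambda>z. \<Sum>I\<in>S. of_nat (ideal_norm qfield I) powr - z :: complex) holomorphic_on ball z0 r" for S
      by (meson holomorphic_on_imp_continuous_on holomorphic_on_subset subset_UNIV)
    have "dedekind_series qfield holomorphic_on ball z0 r"
      by (rule holomorphic_uniform_limit[OF _ lim]) (auto intro!: always_eventually partial)
    then show "\<exists>e>0. dedekind_series qfield holomorphic_on ball z0 e"
      using r(1) by blast
  qed
  then show ?thesis
    by (rule analytic_imp_holomorphic)
qed

text \<open>The unit ideal contributes 1. All other ideals inject into a set of triples covered by
  \<open>bound\<close>, so the rest has norm less than 1 and at most \<open>C\<close> - 1.\<close>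

lemma dedekind_series_bounds:
  fixes N :: nat
  assumes "Re s > 1"
    and bound: "\<And>T. (1, 1, 1) \<notin> T \<Longrightarrow> (\<And>m u v. (m, u, v) \<in> T \<Longrightarrow> m > 0 \<and> (u * v = 1 \<or> u * v > N)) \<Longrightarrow>
      infsum (triple_term (Re s)) T < 1 \<and> 1 + infsum (triple_term (Re s)) T \<le> C"
    and noroot: "\<And>p x. Factorial_Ring.prime p \<Longrightarrow> p \<le> N \<Longrightarrow> \<not> int p dvd x ^ 2 + x - k"
  shows "dedekind_series qfield s \<noteq> 0" "norm (dedekind_series qfield s) \<le> C"
proof -
  obtain \<phi> where inj: "inj_on \<phi> (nonzero_ideals qfield)"
    and \<phi>: "\<And>I m u v. I \<in> nonzero_ideals qfield \<Longrightarrow> \<phi> I = (m, u, v) \<Longrightarrow>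
      m > 0 \<and> ideal_norm qfield I = m ^ 2 * u * v \<and> u * v > 0 \<and> (\<exists>b. int (u * v) dvd b ^ 2 + b - k)"
    using ideal_triples by blast
  define f :: "complex set \<Rightarrow> complex" where "f I = of_nat (ideal_norm qfield I) powr - s" for I
  define R where "R = nonzero_ideals qfield - {qint}"
  have injR: "inj_on \<phi> R"
    using inj by (rule inj_on_subset) (auto simp: R_def)
  have norm_f: "norm (f I) = (triple_term (Re s) \<circ> \<phi>) I" if I: "I \<in> R" for I
  proof -
    obtain m u v where muv: "\<phi> I = (m, u, v)"
      by (metis prod_cases3)
    have n: "ideal_norm qfield I = m ^ 2 * u * v"
      using \<phi>[OF _ muv] I by (simp add: R_def)
    have "norm (f I) = real (ideal_norm qfield I) powr - Re s"
      by (simp add: f_def norm_of_nat_powr)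
    also have "\<dots> = (triple_term (Re s) \<circ> \<phi>) I"
      by (simp add: triple_term_def muv n)
    finally show ?thesis .
  qed
  have "(triple_term (Re s) \<circ> \<phi>) summable_on R"
    using summable_on_subset_banach[OF summable_on_triple_term[OF assms(1)]] injR
    by (subst summable_on_reindex[symmetric]) auto
  then have abs: "(\<lambda>I. norm (f I)) summable_on R"
    by (rule summable_on_cong[THEN iffD1, rotated]) (simp add: norm_f)
  \<comment> \<open>Norm 1 forces all entries to be 1; by injectivity no other ideal has this
    triple.\<close>
  have "\<phi> qint = (1, 1, 1)"
  proof -
    obtain m u v where muv: "\<phi> qint = (m, u, v)"
      by (metis prod_cases3)
    then have "m ^ 2 * u * v = 1"
      using \<phi>[OF qint_nonzero_ideal muv] ideal_norm_qint by simp
    then show ?thesis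
      by (simp add: muv)
  qed
  then have "(1, 1, 1) \<notin> \<phi> ` R"
    using inj qint_nonzero_ideal by (metis DiffE R_def imageE inj_onD singletonI)
  moreover have "m > 0 \<and> (u * v = 1 \<or> u * v > N)" if "(m, u, v) \<in> \<phi> ` R" for m u v
  proof -
    from that obtain I where "(m, u, v) = \<phi> I" "I \<in> R"
      by (rule imageE)
    then have I: "I \<in> nonzero_ideals qfield" "\<phi> I = (m, u, v)"
      by (simp_all add: R_def)
    obtain b where b: "int (u * v) dvd b ^ 2 + b - k" and pos: "m > 0" "u * v > 0"
      using \<phi>[OF I] by blast
    have "u * v > N" if "u * v \<noteq> 1"
    proof -
      \<comment> \<open>A prime factor of \<open>u * v\<close> also divides the value of the
        polynomial at \<open>b\<close>, so by \<open>noroot\<close> it exceeds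
        \<open>N\<close>.\<close>
      obtain p where p: "Factorial_Ring.prime p" "p dvd u * v"
        using \<open>u * v \<noteq> 1\<close> prime_factor_nat by blast
      then have "int p dvd b ^ 2 + b - k"
        using b by (meson dvd_trans int_dvd_int_iff)
      then have "p > N"
        using noroot p(1) not_le by blast
      then show ?thesis
        using dvd_imp_le[OF p(2) pos(2)] by linarith
    qed
    then show ?thesis
      using pos by blast
  qed
  ultimately have B: "infsum (triple_term (Re s)) (\<phi> ` R) < 1" "1 + infsum (triple_term (Re s)) (\<phi> ` R) \<le> C"
    using bound by blast+
  have "norm (infsum f R) \<le> infsum (\<lambda>I. norm (f I)) R"
    using abs by (rule norm_infsum_bound)
  also have "\<dots> = infsum (triple_term (Re s) \<circ> \<phi>) R"
    by (rule infsum_cong) (rule norm_f)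
  also have "\<dots> = infsum (triple_term (Re s)) (\<phi> ` R)"
    using injR by (simp add: infsum_reindex)
  finally have rest: "norm (infsum f R) \<le> infsum (triple_term (Re s)) (\<phi> ` R)" .
  have "infsum f ({qint} \<union> R) = infsum f {qint} + infsum f R"
    using abs_summable_summable[OF abs] by (intro infsum_Un_disjoint) (auto simp: R_def)
  moreover have "{qint} \<union> R = nonzero_ideals qfield"
    using qint_nonzero_ideal by (auto simp: R_def)
  moreover have "infsum f {qint} = 1"
    by (simp add: f_def ideal_norm_qint)
  ultimately have eq: "dedekind_series qfield s = 1 + infsum f R"
    by (simp add: dedekind_series_def f_def[abs_def])
  show "dedekind_series qfield s \<noteq> 0"
  proof
    assume "dedekind_series qfield s = 0"
    then have "infsum f R = - 1"
      using eq by (simp add: add_eq_0_iff)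
    then show False
      using rest B(1) by simp
  qed
  show "norm (dedekind_series qfield s) \<le> C"
    using norm_triangle_ineq[of 1 "infsum f R"] rest B(2) by (simp add: eq)
qed

end

section \<open>Infinitely many fields with bounded zeta value\<close>

theorem theorem1p3:
  fixes \<sigma> \<tau> B :: real
  assumes "\<sigma> > 1"
    and "B \<ge> (riemann_zeta \<sigma>)\<^sup>2"
  shows "infinite (northcott_set B (Complex \<sigma> \<tau>))"
proof -
  define s where "s = Complex \<sigma> \<tau>"
  have s: "Re s = \<sigma>" "Re s > 1"
    using assms(1) by (simp_all add: s_def)
  obtain N where N: "\<And>T. (1, 1, 1) \<notin> T \<Longrightarrow> (\<And>m u v. (m, u, v) \<in> T \<Longrightarrow> m > 0 \<and> (u * v = 1 \<or> u * v > N)) \<Longrightarrow>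
      infsum (triple_term \<sigma>) T < 1 \<and> 1 + infsum (triple_term \<sigma>) T \<le> (riemann_zeta \<sigma>)\<^sup>2"
    using infsum_triple_term_bounds[OF assms(1)] by blast
  define G where "G = {k. real_quadratic k \<and>
    (\<forall>p::nat. Factorial_Ring.prime p \<and> p \<le> N \<longrightarrow> (\<forall>x. \<not> int p dvd x ^ 2 + x - k))}"
  have "\<exists>k\<in>G. k > n" for n
  proof -
    \<comment> \<open>The maximum serves two ends: no roots modulo primes up to \<open>N\<close>,
      and \<open>k\<close> beyond the given \<open>n\<close>, so that \<open>G\<close> is
      unbounded.\<close>
    obtain k where k: "k > int (max N (nat n))" "squarefree (4 * k + 1)"
      "\<forall>p::nat. Factorial_Ring.prime p \<and> p \<le> max N (nat n) \<longrightarrow> (\<forall>x. \<not> int p dvd x ^ 2 + x - k)"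
      using exists_squarefree_no_small_roots by blast
    then have "real_quadratic k"
      by (intro real_quadratic.intro) auto
    then have "k \<in> G"
      using k(3) by (auto simp: G_def)
    then show ?thesis
      using k(1) by (intro bexI[of _ k]) linarith+
  qed
  then have "infinite G"
    by (meson bdd_above_finite bdd_above_def not_le)
  moreover have "inj_on (\<lambda>k. iso_class (real_quadratic.qfield k)) G"
    by (rule inj_onI) (auto simp: G_def dest: iso_class_qfield_inj)
  ultimately have "infinite ((\<lambda>k. iso_class (real_quadratic.qfield k)) ` G)"
    by (simp add: finite_image_iff)
  moreover have "iso_class (real_quadratic.qfield k) \<in> northcott_set B s" if "k \<in> G" for k
  proof -
    interpret real_quadratic k
      using that by (simp add: G_def)
    have "dedekind_series qfield s \<noteq> 0" "norm (dedekind_series qfield s) \<le> (riemann_zeta \<sigma>)\<^sup>2"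
      using that N by (intro dedekind_series_bounds[OF s(2), of N "(riemann_zeta \<sigma>)\<^sup>2"]; simp add: G_def s(1))+
    moreover from this have "dedekind_zeta_star qfield s = dedekind_series qfield s"
      using dedekind_zeta_star_eq[OF dedekind_series_holomorphic s(2)] by blast
    ultimately have "norm (dedekind_zeta_star qfield s) \<le> B"
      using assms(2) by simp
    then show ?thesis
      using number_field_qfield unfolding northcott_set_def by blast
  qed
  ultimately show ?thesis
    unfolding s_def[symmetric] by (meson finite_subset image_subsetI)
qed

end
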